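(* Let $G$ be a finitely generated nilpotent group of virtual nilpotency class $c\ge2$. Then $n^c\preceq\operatorname{CL}_G(n)$.
   Context: The virtual nilpotency class of a finitely generated nilpotent group $G$ is the minimal nilpotency class among all finite-index subgroups of $G$ (equivalently, the nilpotency class of $G/\tau(G)$, where $\tau(G)$ is the finite normal subgroup of torsion elements). $\mathbb N=\{1,2,\ldots\}$. Let $G$ be a finitely generated group with a word norm $|\cdot|$ (with respect to a finite generating set). For conjugate $u,v\in G$, let $\operatorname{CL}(u,v)$ be the minimal length $|x|$ of an element $x\in G$ with $x^{-1}ux=v$. The conjugator length function of $G$ is $\operatorname{CL}_G(n)=\max\{\operatorname{CL}(u,v)\mid u,v\in G\text{ conjugate},\ |u|,|v|\le n\}$. For $f,g\colon\mathbb N\to[0,\infty)$ write $f\preceq g$ if there is an integer $C\ge1$ with $f(n)\le C\,g(Cn+C)+C$ for all $n\in\mathbb N$. *)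

theory Defs
  imports Complex_Main "HOL-Algebra.Generated_Groups"
begin

section \<open>Nilpotency\<close>

text \<open>Indexing starts at 0: the term with index \<open>n\<close> is the subgroup usually written
  \<open>\<gamma>\<^sub>n\<^sub>+\<^sub>1(G)\<close>, so that the nilpotency class is the least index of a trivial term.\<close>

primrec lower_central :: "('a, 'b) monoid_scheme \<Rightarrow> nat \<Rightarrow> 'a set" where
  "lower_central G 0 = carrier G"
| "lower_central G (Suc n) =
     generate G (\<Union>x \<in> lower_central G n. \<Union>y \<in> carrier G.
       {x \<otimes>\<^bsub>G\<^esub> y \<otimes>\<^bsub>G\<^esub> inv\<^bsub>G\<^esub> x \<otimes>\<^bsub>G\<^esub> inv\<^bsub>G\<^esub> y})"

definition nilpotent :: "('a, 'b) monoid_scheme \<Rightarrow> bool" where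
  "nilpotent G \<longleftrightarrow> (\<exists>n. lower_central G n = {\<one>\<^bsub>G\<^esub>})"

text \<open>Only meaningful for nilpotent groups; the trivial group has class 0.\<close>

definition nilpotency_class :: "('a, 'b) monoid_scheme \<Rightarrow> nat" where
  "nilpotency_class G = (LEAST n. lower_central G n = {\<one>\<^bsub>G\<^esub>})"

definition finite_index :: "('a, 'b) monoid_scheme \<Rightarrow> 'a set \<Rightarrow> bool" where
  "finite_index G H \<longleftrightarrow> subgroup H G \<and> finite (rcosets\<^bsub>G\<^esub> H)"

text \<open>Used for nilpotent \<open>G\<close>, in which every subgroup \<open>H\<close> is nilpotent as well.\<close>

definition virtual_nilpotency_class :: "('a, 'b) monoid_scheme \<Rightarrow> nat" where
  "virtual_nilpotency_class G =
     (LEAST k. \<exists>H. finite_index G H \<and> nilpotency_class (G\<lparr>carrier := H\<rparr>) = k)"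


section \<open>Word norm and conjugator length\<close>

definition finite_generating_set :: "('a, 'b) monoid_scheme \<Rightarrow> 'a set \<Rightarrow> bool" where
  "finite_generating_set G S \<longleftrightarrow>
     finite S \<and> S \<subseteq> carrier G \<and> generate G S = carrier G"

definition word_norm :: "('a, 'b) monoid_scheme \<Rightarrow> 'a set \<Rightarrow> 'a \<Rightarrow> nat" where
  "word_norm G S g =
     (LEAST n. \<exists>w. length w = n \<and> set w \<subseteq> S \<union> m_inv G ` S \<and>
        foldr (\<lambda>x y. x \<otimes>\<^bsub>G\<^esub> y) w \<one>\<^bsub>G\<^esub> = g)"

definition conjugate :: "('a, 'b) monoid_scheme \<Rightarrow> 'a \<Rightarrow> 'a \<Rightarrow> bool" where
  "conjugate G u v \<longleftrightarrow> u \<in> carrier G \<and> v \<in> carrier G \<and>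
     (\<exists>x \<in> carrier G. inv\<^bsub>G\<^esub> x \<otimes>\<^bsub>G\<^esub> u \<otimes>\<^bsub>G\<^esub> x = v)"

definition conj_length :: "('a, 'b) monoid_scheme \<Rightarrow> 'a set \<Rightarrow> 'a \<Rightarrow> 'a \<Rightarrow> nat" where
  "conj_length G S u v =
     (LEAST l. \<exists>x \<in> carrier G. inv\<^bsub>G\<^esub> x \<otimes>\<^bsub>G\<^esub> u \<otimes>\<^bsub>G\<^esub> x = v \<and> word_norm G S x = l)"

text \<open>For a finite generating set \<open>S\<close> the balls of the word norm are finite, so that the
  maximum is over a finite set, which contains \<open>conj_length G S \<one> \<one>\<close>.\<close>

definition conj_length_function :: "('a, 'b) monoid_scheme \<Rightarrow> 'a set \<Rightarrow> nat \<Rightarrow> nat" where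
  "conj_length_function G S n =
     Max {conj_length G S u v | u v.
       conjugate G u v \<and> word_norm G S u \<le> n \<and> word_norm G S v \<le> n}"


section \<open>Comparison of growth functions\<close>

text \<open>Functions on the positive integers are represented by functions on \<^typ>\<open>nat\<close> whose value
  at 0 is irrelevant: the arguments below are positive.\<close>

definition growth_le :: "(nat \<Rightarrow> real) \<Rightarrow> (nat \<Rightarrow> real) \<Rightarrow> bool" (infix \<open>\<preceq>\<^sub>g\<close> 50) where
  "f \<preceq>\<^sub>g g \<longleftrightarrow>
     (\<exists>C::nat. C \<ge> 1 \<and> (\<forall>n \<ge> 1. f n \<le> real C * g (C * n + C) + real C))"

end

theory Submission
  imports Defs "HOL-Algebra.Multiplicative_Group"
begin

text \<open>Let \<open>N\<close> be a normal subgroup of finite index whose class is the virtual class \<open>c\<close> of \<open>G\<close>.  The bound comes from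
  two facts about iterated commutators of weight \<open>c\<close> in \<open>N\<close>.

  They are multilinear, with values in the centre of \<open>N\<close>
  (\<open>iterated_commutator_pow\<close>): if \<open>z\<close> is the commutator of \<open>t\<^sub>1, \<dots>, t\<^sub>c\<close>, then \<open>z\<close> to the
  power \<open>n\<^sup>c\<close> is the commutator of their \<open>n\<close>-th powers, and so it has length
  linear in \<open>n\<close>.  Moreover \<open>z\<close> can be chosen of infinite order with all entries in a finite
  generating set of \<open>N\<close>.  Otherwise the elements \<open>h\<close> such that all commutators of weight \<open>c\<close> with
  first entry \<open>h\<close> vanish would form a subgroup of finite index and of class less
  than \<open>c\<close> (\<open>torsion_commutators_imp_finite_index_lower_class\<close>).

  Now let \<open>z = [u, h]\<close>, where \<open>u\<close> is the commutator of the first \<open>c - 1\<close> entries and \<open>h\<close> is the last entry.  The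
  power of \<open>h\<close> with exponent \<open>n\<^sup>c\<close> conjugates \<open>u\<close> to \<open>v\<close>, the product of \<open>u\<close> and the power of \<open>z\<close> with
  the same exponent, so \<open>u\<close> and \<open>v\<close> are conjugate elements of length \<open>O(n)\<close>.  On the other
  hand \<open>g \<mapsto> g\<^sup>-\<^sup>1 u g u\<^sup>-\<^sup>1\<close> is a homomorphism from \<open>N\<close> to its centre.  A conjugator in \<open>N\<close> has to be mapped
  to the power of \<open>z\<close>, and an element of infinite order is undistorted in a finitely
  generated abelian group, so every conjugator has length at least a constant times
  \<open>n\<^sup>c\<close>, up to an additive constant.  Conjugators outside \<open>N\<close> are reduced to this situation by writing them as an
  element of \<open>N\<close> times one of finitely many coset representatives, with control of the lengths
  (\<open>schreier_rewriting\<close>, \<open>conjugator_length_linear_bound\<close>).\<close>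

section \<open>Commutators and the lower central series\<close>

definition commutator :: "('a, 'b) monoid_scheme \<Rightarrow> 'a \<Rightarrow> 'a \<Rightarrow> 'a" where
  "commutator G x y = x \<otimes>\<^bsub>G\<^esub> y \<otimes>\<^bsub>G\<^esub> inv\<^bsub>G\<^esub> x \<otimes>\<^bsub>G\<^esub> inv\<^bsub>G\<^esub> y"

abbreviation iterated_commutator :: "('a, 'b) monoid_scheme \<Rightarrow> 'a \<Rightarrow> 'a list \<Rightarrow> 'a" where
  "iterated_commutator G \<equiv> foldl (commutator G)"

definition center :: "('a, 'b) monoid_scheme \<Rightarrow> 'a set" where
  "center G = {z \<in> carrier G. \<forall>x \<in> carrier G. z \<otimes>\<^bsub>G\<^esub> x = x \<otimes>\<^bsub>G\<^esub> z}"

declare lower_central.simps(2) [simp del]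

context group
begin

lemma inv_mult_cancel:
  assumes "x \<in> carrier G" "y \<in> carrier G"
  shows "inv x \<otimes> (x \<otimes> y) = y" and "x \<otimes> (inv x \<otimes> y) = y"
  using assms by (simp_all flip: m_assoc)

lemmas word_simps = m_assoc inv_mult_group inv_mult_cancel

lemma commutator_closed [simp]:
  "x \<in> carrier G \<Longrightarrow> y \<in> carrier G \<Longrightarrow> commutator G x y \<in> carrier G"
  by (simp add: commutator_def)

lemma iterated_commutator_closed [simp]:
  "x \<in> carrier G \<Longrightarrow> set ys \<subseteq> carrier G \<Longrightarrow> iterated_commutator G x ys \<in> carrier G"
  by (induction ys arbitrary: x) auto

lemma iterated_commutator_one:
  assumes "set ys \<subseteq> carrier G"
  shows "iterated_commutator G \<one> ys = \<one>"
  using assms by (induction ys) (auto simp: commutator_def)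

lemma center_subgroup: "subgroup (center G) G"
proof (rule subgroupI)
  show "center G \<noteq> {}" unfolding center_def using one_closed by force
next
  fix a assume "a \<in> center G"
  then have a: "a \<in> carrier G" "\<And>x. x \<in> carrier G \<Longrightarrow> a \<otimes> x = x \<otimes> a" by (auto simp: center_def)
  have "inv a \<otimes> x = x \<otimes> inv a" if x: "x \<in> carrier G" for x
    using arg_cong[OF a(2)[OF inv_closed[OF x]], of "m_inv G"] a(1) x by (simp add: inv_mult_group)
  then show "inv a \<in> center G" using a(1) by (simp add: center_def)
next
  fix a b assume "a \<in> center G" "b \<in> center G"
  then have ab: "a \<in> carrier G" "\<And>x. x \<in> carrier G \<Longrightarrow> a \<otimes> x = x \<otimes> a"
    "b \<in> carrier G" "\<And>x. x \<in> carrier G \<Longrightarrow> b \<otimes> x = x \<otimes> b" by (auto simp: center_def)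
  have "a \<otimes> b \<otimes> x = x \<otimes> (a \<otimes> b)" if x: "x \<in> carrier G" for x
  proof -
    have "a \<otimes> b \<otimes> x = a \<otimes> (x \<otimes> b)" using ab(1,3) ab(4)[OF x] x by (simp add: m_assoc)
    also have "\<dots> = x \<otimes> a \<otimes> b" using ab(1,3) ab(2)[OF x] x by (simp flip: m_assoc)
    finally show ?thesis using ab(1,3) x by (simp add: m_assoc)
  qed
  then show "a \<otimes> b \<in> center G" using ab(1,3) by (simp add: center_def)
qed (auto simp: center_def)

lemma center_comm_group: "comm_group (G\<lparr>carrier := center G\<rparr>)"
proof -
  interpret Z: group "G\<lparr>carrier := center G\<rparr>"
    using center_subgroup by (rule subgroup_imp_group)
  show ?thesis
  proof (rule Z.group_comm_groupI)
    fix x y assume "x \<in> carrier (G\<lparr>carrier := center G\<rparr>)" "y \<in> carrier (G\<lparr>carrier := center G\<rparr>)"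
    then have "x \<in> center G" "y \<in> carrier G" by (simp_all add: center_def)
    then have "x \<otimes> y = y \<otimes> x" unfolding center_def by blast
    then show "x \<otimes>\<^bsub>G\<lparr>carrier := center G\<rparr>\<^esub> y = y \<otimes>\<^bsub>G\<lparr>carrier := center G\<rparr>\<^esub> x" by simp
  qed
qed

lemma lower_central_Suc_eq:
  "lower_central G (Suc n) = generate G {commutator G x y |x y. x \<in> lower_central G n \<and> y \<in> carrier G}"
  unfolding lower_central.simps commutator_def by (rule arg_cong[where f = "generate G"]) auto

text \<open>Both facts go by one induction: a commutator with an entry in a normal subgroup lies in that
  subgroup, and conversely a subgroup of \<open>lower_central G n\<close> that contains all its commutators
  with elements of \<open>G\<close> is normal.\<close>
lemma lower_central_normal: "lower_central G n \<lhd> G"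
  and lower_central_Suc_subset: "lower_central G (Suc n) \<subseteq> lower_central G n"
proof -
  have step: "lower_central G (Suc n) \<lhd> G \<and> lower_central G (Suc n) \<subseteq> lower_central G n"
    if N: "lower_central G n \<lhd> G" for n
  proof -
    interpret N: normal "lower_central G n" G by (rule N)
    let ?C = "{commutator G x y |x y. x \<in> lower_central G n \<and> y \<in> carrier G}"
    have C: "?C \<subseteq> lower_central G n"
    proof safe
      fix x y assume x: "x \<in> lower_central G n" and y: "y \<in> carrier G"
      have "commutator G x y = x \<otimes> (y \<otimes> inv x \<otimes> inv y)"
        using x y by (simp add: commutator_def m_assoc)
      also have "\<dots> \<in> lower_central G n"
        using x y by (intro N.m_closed N.inv_op_closed2) auto
      finally show "commutator G x y \<in> lower_central G n" .
    qed
    then have Cc: "?C \<subseteq> carrier G" using N.subset by blast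
    have le: "lower_central G (Suc n) \<subseteq> lower_central G n"
      unfolding lower_central_Suc_eq using C N.subgroup_axioms by (rule generate_subgroup_incl)
    have sg: "subgroup (lower_central G (Suc n)) G"
      unfolding lower_central_Suc_eq using Cc by (rule generate_is_subgroup)
    have "lower_central G (Suc n) \<lhd> G"
    proof (rule normal_invI[OF sg])
      fix g k assume g: "g \<in> carrier G" and k: "k \<in> lower_central G (Suc n)"
      then have kn: "k \<in> lower_central G n" using le by blast
      then have kc [simp]: "k \<in> carrier G" by auto
      have c: "commutator G k g \<in> lower_central G (Suc n)"
        unfolding lower_central_Suc_eq using kn g by (blast intro: generate.incl)
      have "g \<otimes> k \<otimes> inv g = inv (commutator G k g) \<otimes> k"
        using g by (simp add: commutator_def word_simps)
      also have "\<dots> \<in> lower_central G (Suc n)"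
        using sg c k by (simp add: subgroup.m_closed subgroup.m_inv_closed)
      finally show "g \<otimes> k \<otimes> inv g \<in> lower_central G (Suc n)" .
    qed
    with le show ?thesis by blast
  qed
  have nrm: "lower_central G n \<lhd> G" for n
  proof (induction n)
    case 0 show ?case by (simp add: normal_invI subgroup_self)
  next
    case (Suc n) then show ?case using step by blast
  qed
  show "lower_central G n \<lhd> G" by (rule nrm)
  show "lower_central G (Suc n) \<subseteq> lower_central G n" using step[OF nrm] by blast
qed

lemmas lower_central_subgroup = normal_imp_subgroup[OF lower_central_normal]

lemma lower_central_carrier: "x \<in> lower_central G n \<Longrightarrow> x \<in> carrier G"
  using lower_central_subgroup by (rule subgroup.mem_carrier)

lemma commutator_in_lower_central:
  "x \<in> lower_central G n \<Longrightarrow> y \<in> carrier G \<Longrightarrow> commutator G x y \<in> lower_central G (Suc n)"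
  unfolding lower_central_Suc_eq by (blast intro: generate.incl)

lemma commutator_in_lower_central':
  assumes "x \<in> carrier G" "y \<in> lower_central G n"
  shows "commutator G x y \<in> lower_central G (Suc n)"
proof -
  have "commutator G x y = inv (commutator G y x)"
    using assms lower_central_carrier by (simp add: commutator_def word_simps)
  then show ?thesis
    using assms by (simp add: subgroup.m_inv_closed[OF lower_central_subgroup] commutator_in_lower_central)
qed

lemma iterated_commutator_in_lower_central:
  "x \<in> lower_central G n \<Longrightarrow> set ys \<subseteq> carrier G
    \<Longrightarrow> iterated_commutator G x ys \<in> lower_central G (n + length ys)"
proof (induction ys arbitrary: x n)
  case (Cons y ys)
  then have "iterated_commutator G (commutator G x y) ys \<in> lower_central G (Suc n + length ys)"
    by (intro Cons.IH commutator_in_lower_central) auto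
  then show ?case by simp
qed simp

lemma lower_central_antimono: "m \<le> n \<Longrightarrow> lower_central G n \<subseteq> lower_central G m"
  using lower_central_Suc_subset by (rule lift_Suc_antimono_le)

lemma commutator_one_imp_commute:
  assumes "x \<in> carrier G" "y \<in> carrier G" "commutator G x y = \<one>"
  shows "x \<otimes> y = y \<otimes> x"
proof -
  have "x \<otimes> y = commutator G x y \<otimes> (y \<otimes> x)"
    using assms(1,2) by (simp add: commutator_def word_simps)
  then show ?thesis using assms by simp
qed

lemma last_lower_central_subset_center:
  assumes "lower_central G (Suc k) = {\<one>}"
  shows "lower_central G k \<subseteq> center G"
proof
  fix z assume z: "z \<in> lower_central G k"
  have "commutator G z x = \<one>" if "x \<in> carrier G" for x
    using commutator_in_lower_central[OF z that] assms by simp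
  then show "z \<in> center G"
    using commutator_one_imp_commute lower_central_carrier[OF z] by (simp add: center_def)
qed

text \<open>The correction terms in the next two identities are commutators of one step higher depth in the
  lower central series than the other factors; this is what makes iterated commutators additive
  modulo the next term.\<close>
lemma commutator_mult_left:
  assumes "x \<in> carrier G" "x' \<in> carrier G" "y \<in> carrier G"
  shows "commutator G (x \<otimes> x') y =
    commutator G x (commutator G x' y) \<otimes> commutator G x' y \<otimes> commutator G x y"
  using assms by (simp add: commutator_def word_simps)

lemma commutator_mult_right:
  assumes "x \<in> carrier G" "y \<in> carrier G" "y' \<in> carrier G"
  shows "commutator G x (y \<otimes> y') =
    commutator G x y \<otimes> commutator G y (commutator G x y') \<otimes> commutator G x y'"
  using assms by (simp add: commutator_def word_simps)

end

section \<open>Multilinearity of iterated commutators\<close>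

text \<open>The groups of nilpotency class at most \<open>k + 1\<close>.  In such a group an iterated commutator with
  \<open>k + 1\<close> entries is central and multiplicative in each entry.\<close>

locale group_of_class_Suc = group +
  fixes k :: nat
  assumes lower_central_trivial: "lower_central G (Suc k) = {\<one>}"
begin

lemma iterated_commutator_trivial:
  assumes "x \<in> lower_central G n" "set ys \<subseteq> carrier G" "k < n + length ys"
  shows "iterated_commutator G x ys = \<one>"
proof -
  have "iterated_commutator G x ys \<in> lower_central G (n + length ys)"
    using assms by (intro iterated_commutator_in_lower_central)
  also have "\<dots> \<subseteq> lower_central G (Suc k)" using assms(3) by (intro lower_central_antimono) simp
  finally show ?thesis using lower_central_trivial by simp
qed

lemma iterated_commutator_central:
  assumes "x \<in> lower_central G n" "set ys \<subseteq> carrier G" "n + length ys = k"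
  shows "iterated_commutator G x ys \<in> center G"
  using iterated_commutator_in_lower_central[OF assms(1,2)] assms(3)
    last_lower_central_subset_center[OF lower_central_trivial] by auto

text \<open>The first entry is allowed to lie in \<open>lower_central G n\<close> so that induction on the list works: the
  element \<open>commutator G (x \<otimes> x') y\<close> is the product of two commutators with entry \<open>y\<close>
  and of an element so deep that all later commutators kill it, and the
  induction hypothesis applies to these three factors.\<close>
lemma iterated_commutator_mult:
  assumes "x \<in> lower_central G n" "x' \<in> lower_central G n" "set ys \<subseteq> carrier G" "n + length ys = k"
  shows "iterated_commutator G (x \<otimes> x') ys = iterated_commutator G x ys \<otimes> iterated_commutator G x' ys"
  using assms
proof (induction ys arbitrary: x x' n)
  case (Cons y ys)
  let ?L = "lower_central G (Suc n)"
  have car: "x \<in> carrier G" "x' \<in> carrier G" "y \<in> carrier G" and ys: "set ys \<subseteq> carrier G"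
    using Cons.prems lower_central_carrier by auto
  have a: "commutator G x y \<in> ?L" and b: "commutator G x' y \<in> ?L"
    using Cons.prems car by (auto intro: commutator_in_lower_central)
  have e: "commutator G x (commutator G x' y) \<in> lower_central G (Suc (Suc n))"
    using car(1) b by (rule commutator_in_lower_central')
  then have d: "commutator G x (commutator G x' y) \<in> ?L"
    using lower_central_Suc_subset by blast
  have len: "Suc n + length ys = k" using Cons.prems by simp
  note IH = Cons.IH[OF _ _ ys len]
  have "iterated_commutator G (x \<otimes> x') (y # ys) =
      iterated_commutator G (commutator G x (commutator G x' y) \<otimes> commutator G x' y) ys
        \<otimes> iterated_commutator G (commutator G x y) ys"
    using a b d car by (simp add: commutator_mult_left IH subgroup.m_closed[OF lower_central_subgroup])
  also have "\<dots> = iterated_commutator G (commutator G x' y) ys \<otimes> iterated_commutator G (commutator G x y) ys"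
    using b d car ys len by (simp add: IH iterated_commutator_trivial[OF e ys])
  also have "\<dots> = iterated_commutator G (commutator G x y) ys \<otimes> iterated_commutator G (commutator G x' y) ys"
    using iterated_commutator_central[OF a ys len] car ys by (simp add: center_def)
  finally show ?case by simp
qed simp

text \<open>The statement covers every entry but the first one, since \<open>x\<close> may itself be an iterated
  commutator.\<close>
lemma iterated_commutator_mult_second:
  assumes "x \<in> lower_central G n" "y \<in> carrier G" "y' \<in> carrier G" "set ys \<subseteq> carrier G"
    "Suc n + length ys = k"
  shows "iterated_commutator G x ((y \<otimes> y') # ys) =
    iterated_commutator G x (y # ys) \<otimes> iterated_commutator G x (y' # ys)"
proof -
  let ?L = "lower_central G (Suc n)"
  have x: "x \<in> carrier G" using assms lower_central_carrier by auto
  have a: "commutator G x y \<in> ?L" and b: "commutator G x y' \<in> ?L"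
    using assms by (auto intro: commutator_in_lower_central)
  have e: "commutator G y (commutator G x y') \<in> lower_central G (Suc (Suc n))"
    using assms(2) b by (rule commutator_in_lower_central')
  then have e': "commutator G y (commutator G x y') \<in> ?L"
    using lower_central_Suc_subset by blast
  note H = iterated_commutator_mult[OF _ _ assms(4,5)]
  show ?thesis
    using a b e' x assms
    by (simp add: commutator_mult_right H subgroup.m_closed[OF lower_central_subgroup]
        iterated_commutator_trivial[OF e assms(4)])
qed

lemma iterated_commutator_hom:
  assumes "set ys \<subseteq> carrier G" "length ys = k"
  shows "(\<lambda>x. iterated_commutator G x ys) \<in> hom G G"
  using assms iterated_commutator_mult[of _ 0] by (auto simp: hom_def)

lemma iterated_commutator_hom_second:
  assumes "x \<in> lower_central G n" "set ys \<subseteq> carrier G" "Suc n + length ys = k"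
  shows "(\<lambda>y. iterated_commutator G x (y # ys)) \<in> hom G G"
  using assms iterated_commutator_mult_second[OF assms(1)] lower_central_carrier
  by (auto simp: hom_def)

lemma iterated_commutator_map_pow:
  assumes "x \<in> lower_central G n" "set ys \<subseteq> carrier G" "n + length ys = k"
  shows "iterated_commutator G x (map (\<lambda>y. y [^] (m::nat)) ys)
    = iterated_commutator G x ys [^] (m ^ length ys)"
  using assms
proof (induction ys arbitrary: x n)
  case Nil
  then show ?case using lower_central_carrier by simp
next
  case (Cons y ys)
  have xy: "x \<in> carrier G" "y \<in> carrier G" "set ys \<subseteq> carrier G" and len: "Suc n + length ys = k"
    using Cons.prems lower_central_carrier by auto
  have "iterated_commutator G x (map (\<lambda>y. y [^] m) (y # ys))
      = iterated_commutator G x ((y [^] m) # ys) [^] (m ^ length ys)"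
    using Cons.IH[OF commutator_in_lower_central[OF Cons.prems(1)] xy(3) len] xy by simp
  also have "iterated_commutator G x ((y [^] m) # ys) = iterated_commutator G x (y # ys) [^] m"
    using hom_nat_pow[OF iterated_commutator_hom_second[OF Cons.prems(1) xy(3) len]] xy is_group
    by auto
  finally show ?case using xy by (simp add: nat_pow_pow)
qed

text \<open>Replacing each of the \<open>k + 1\<close> entries by its \<open>m\<close>-th power raises the commutator to the power
  \<open>m ^ Suc k\<close>, although its expression as a word grows only linearly in \<open>m\<close>.  This distortion is
  the source of the degree in the lower bound.\<close>

lemma iterated_commutator_pow:
  assumes "x \<in> carrier G" "set ys \<subseteq> carrier G" "length ys = k"
  shows "iterated_commutator G (x [^] (m::nat)) (map (\<lambda>y. y [^] m) ys)
    = iterated_commutator G x ys [^] (m ^ Suc k)"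
proof -
  have "iterated_commutator G (x [^] m) (map (\<lambda>y. y [^] m) ys)
      = iterated_commutator G (x [^] m) ys [^] (m ^ k)"
    using assms by (subst iterated_commutator_map_pow[of _ 0]) auto
  also have "iterated_commutator G (x [^] m) ys = iterated_commutator G x ys [^] m"
    using hom_nat_pow[OF iterated_commutator_hom[OF assms(2,3)] assms(1) is_group is_group] .
  finally show ?thesis using assms by (simp add: nat_pow_pow)
qed

text \<open>A multilinear map that vanishes on the tuples of generators is zero.\<close>

lemma iterated_commutator_vanishes:
  assumes T: "T \<subseteq> carrier G" "generate G T = carrier G"
    and "x \<in> lower_central G n"
    and "\<And>ts. set ts \<subseteq> T \<Longrightarrow> n + length ts = k \<Longrightarrow> iterated_commutator G x ts = \<one>"
    and "set ys \<subseteq> carrier G" "n + length ys = k"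
  shows "iterated_commutator G x ys = \<one>"
  using assms(3-)
proof (induction ys arbitrary: x n)
  case Nil
  then show ?case using Nil.prems(2)[of "[]"] by simp
next
  case (Cons y ys)
  have ys: "set ys \<subseteq> carrier G" and y: "y \<in> carrier G" and len: "Suc n + length ys = k"
    using Cons.prems by auto
  let ?f = "\<lambda>y. iterated_commutator G x (y # ys)"
  interpret f: group_hom G G ?f
    using iterated_commutator_hom_second[OF Cons.prems(1) ys len]
    by (simp add: group_hom.intro group_hom_axioms.intro is_group)
  have "T \<subseteq> kernel G G ?f"
  proof
    fix t assume t: "t \<in> T"
    have "iterated_commutator G (commutator G x t) ys = \<one>"
    proof (rule Cons.IH[OF _ _ ys len])
      show "commutator G x t \<in> lower_central G (Suc n)"
        using Cons.prems(1) t T by (blast intro: commutator_in_lower_central)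
      show "iterated_commutator G (commutator G x t) ts = \<one>"
        if "set ts \<subseteq> T" "Suc n + length ts = k" for ts
        using Cons.prems(2)[of "t # ts"] that t by simp
    qed
    then show "t \<in> kernel G G ?f" using t T by (auto simp: kernel_def)
  qed
  then have "generate G T \<subseteq> kernel G G ?f"
    using f.subgroup_kernel by (rule generate_subgroup_incl)
  then show ?case using y T by (auto simp: kernel_def)
qed

end

section \<open>Subgroups of finite index\<close>

context group
begin

lemma finite_index_transversal:
  assumes "finite_index G H"
  obtains r where "\<And>x. x \<in> carrier G \<Longrightarrow> r x \<in> carrier G"
    and "\<And>x. x \<in> carrier G \<Longrightarrow> x \<otimes> inv (r x) \<in> H"
    and "finite (r ` carrier G)" and "\<And>x. x \<in> H \<Longrightarrow> r x = \<one>"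
proof -
  interpret H: subgroup H G using assms by (simp add: finite_index_def)
  define s where "s C = (if C = H then \<one> else (SOME y. y \<in> C))" for C
  have self: "x \<in> H #> x" if "x \<in> carrier G" for x
    using that H.subgroup_axioms by (rule rcos_self)
  have s: "s (H #> x) \<in> H #> x" if x: "x \<in> carrier G" for x
  proof (cases "H #> x = H")
    case True
    then show ?thesis unfolding s_def True by simp
  next
    case False
    then show ?thesis unfolding s_def using self[OF x] by (auto intro: someI)
  qed
  show thesis
  proof (rule that[of "\<lambda>x. s (H #> x)"])
    fix x assume x: "x \<in> carrier G"
    show c: "s (H #> x) \<in> carrier G"
      using s[OF x] H.elemrcos_carrier[OF is_group x] by blast
    have "inv (s (H #> x) \<otimes> inv x) \<in> H"
      using H.rcos_module_imp[OF is_group x s[OF x]] by (rule H.m_inv_closed)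
    then show "x \<otimes> inv (s (H #> x)) \<in> H" using x c by (simp add: inv_mult_group)
  next
    have "(\<lambda>x. s (H #> x)) ` carrier G \<subseteq> s ` (rcosets H)" by (auto simp: RCOSETS_def)
    then show "finite ((\<lambda>x. s (H #> x)) ` carrier G)"
      using assms finite_subset by (auto simp: finite_index_def)
  next
    fix x assume "x \<in> H"
    then show "s (H #> x) = \<one>" using H.rcos_const[OF is_group] by (simp add: s_def)
  qed
qed

text \<open>A map to a finite set whose fibres lie in single cosets bounds the number of cosets.  Every proof
  that a subgroup has finite index below goes through such a map.\<close>

lemma finite_indexI:
  assumes "subgroup H G" and "finite B" and "\<And>x. x \<in> carrier G \<Longrightarrow> f x \<in> B"
    and "\<And>x y. x \<in> carrier G \<Longrightarrow> y \<in> carrier G \<Longrightarrow> f x = f y \<Longrightarrow> x \<otimes> inv y \<in> H"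
  shows "finite_index G H"
proof -
  interpret H: subgroup H G by (rule assms(1))
  have "rcosets H \<subseteq> (\<lambda>b. H #> inv_into (carrier G) f b) ` f ` carrier G"
  proof
    fix C assume "C \<in> rcosets H"
    then obtain x where x: "x \<in> carrier G" "C = H #> x" by (auto simp: RCOSETS_def)
    let ?y = "inv_into (carrier G) f (f x)"
    have y: "?y \<in> carrier G" "f ?y = f x" using x by (auto intro: inv_into_into f_inv_into_f)
    have "?y \<in> H #> x"
      using assms(4)[OF y(1) x(1) y(2)] by (rule H.rcos_module_rev[OF is_group x(1) y(1)])
    then have "C = H #> ?y"
      using x repr_independence[OF _ x(1) H.subgroup_axioms] by simp
    then show "C \<in> (\<lambda>b. H #> inv_into (carrier G) f b) ` f ` carrier G" using x by blast
  qed
  moreover have "finite (f ` carrier G)" using assms(2,3) by (auto intro: finite_subset)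
  ultimately show ?thesis
    unfolding finite_index_def using assms(1) finite_subset by blast
qed

lemma finite_index_trans:
  assumes N: "finite_index G N" and K: "finite_index (G\<lparr>carrier := N\<rparr>) K"
  shows "finite_index G K"
proof -
  interpret N: subgroup N G using N by (simp add: finite_index_def)
  interpret GN: group "G\<lparr>carrier := N\<rparr>" by (rule N.subgroup_is_group[OF is_group])
  obtain r where r: "\<And>x. x \<in> carrier G \<Longrightarrow> r x \<in> carrier G"
      "\<And>x. x \<in> carrier G \<Longrightarrow> x \<otimes> inv (r x) \<in> N" "finite (r ` carrier G)"
    using finite_index_transversal[OF N] by metis
  obtain q where q: "\<And>x. x \<in> N \<Longrightarrow> q x \<in> N"
      "\<And>x. x \<in> N \<Longrightarrow> x \<otimes> inv\<^bsub>G\<lparr>carrier := N\<rparr>\<^esub> (q x) \<in> K" "finite (q ` N)"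
    using GN.finite_index_transversal[OF K, simplified] by metis
  have q2: "x \<otimes> inv (q x) \<in> K" if "x \<in> N" for x
    using q(1,2)[OF that] N.subgroup_axioms by simp
  have sK: "subgroup K G"
    using K N.subgroup_axioms incl_subgroup by (auto simp: finite_index_def)
  interpret K: subgroup K G by (rule sK)
  show ?thesis
  proof (rule finite_indexI[OF sK, where B = "r ` carrier G \<times> q ` N" and f = "\<lambda>x. (r x, q (x \<otimes> inv (r x)))"])
    show "finite (r ` carrier G \<times> q ` N)" using r(3) q(3) by simp
    show "(r x, q (x \<otimes> inv (r x))) \<in> r ` carrier G \<times> q ` N" if "x \<in> carrier G" for x
      using that r by auto
    fix x y
    assume x: "x \<in> carrier G" and y: "y \<in> carrier G"
      and eq: "(r x, q (x \<otimes> inv (r x))) = (r y, q (y \<otimes> inv (r y)))"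
    define a b where "a = r x" and "b = q (x \<otimes> inv (r x))"
    have ab: "a \<in> carrier G" "b \<in> carrier G"
      using r(1)[OF x] q(1)[OF r(2)[OF x]] by (auto simp: a_def b_def)
    have "x \<otimes> inv a \<otimes> inv b \<in> K" "y \<otimes> inv a \<otimes> inv b \<in> K"
      using q2[OF r(2)[OF x]] q2[OF r(2)[OF y]] eq unfolding a_def b_def by auto
    then have "(x \<otimes> inv a \<otimes> inv b) \<otimes> inv (y \<otimes> inv a \<otimes> inv b) \<in> K" by simp
    then show "x \<otimes> inv y \<in> K" using x y ab by (simp add: word_simps)
  qed
qed

text \<open>An element \<open>g\<close> acts on the finitely many cosets of \<open>H\<close>, and the elements that act trivially form the
  intersection of the conjugates of \<open>H\<close>.\<close>
lemma finite_index_normal_core: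
  assumes "finite_index G H"
  obtains N where "N \<lhd> G" "N \<subseteq> H" "finite_index G N"
proof -
  interpret H: subgroup H G using assms by (simp add: finite_index_def)
  define N where "N = {g \<in> carrier G. \<forall>x \<in> carrier G. x \<otimes> g \<otimes> inv x \<in> H}"
  have sN: "subgroup N G"
  proof (rule subgroupI)
    show "N \<noteq> {}" unfolding N_def using one_closed by force
  next
    fix a assume a: "a \<in> N"
    have "x \<otimes> inv a \<otimes> inv x \<in> H" if x: "x \<in> carrier G" for x
    proof -
      have "inv (x \<otimes> a \<otimes> inv x) \<in> H" using a x by (auto simp: N_def)
      then show ?thesis using a x by (simp add: N_def word_simps)
    qed
    then show "inv a \<in> N" using a by (simp add: N_def)
  next
    fix a b assume a: "a \<in> N" and b: "b \<in> N"
    have "x \<otimes> (a \<otimes> b) \<otimes> inv x \<in> H" if x: "x \<in> carrier G" for x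
    proof -
      have "(x \<otimes> a \<otimes> inv x) \<otimes> (x \<otimes> b \<otimes> inv x) \<in> H" using a b x by (auto simp: N_def)
      then show ?thesis using a b x by (simp add: N_def word_simps)
    qed
    then show "a \<otimes> b \<in> N" using a b by (simp add: N_def)
  qed (auto simp: N_def)
  have nN: "N \<lhd> G"
  proof (rule normal_invI[OF sN])
    fix y h assume y: "y \<in> carrier G" and h: "h \<in> N"
    have "x \<otimes> (y \<otimes> h \<otimes> inv y) \<otimes> inv x \<in> H" if x: "x \<in> carrier G" for x
    proof -
      have "(x \<otimes> y) \<otimes> h \<otimes> inv (x \<otimes> y) \<in> H" using h x y by (simp add: N_def del: inv_mult_group)
      then show ?thesis using h x y by (simp add: N_def word_simps)
    qed
    then show "y \<otimes> h \<otimes> inv y \<in> N" using y h by (simp add: N_def)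
  qed
  have NH: "N \<subseteq> H"
  proof
    fix g assume "g \<in> N"
    then have g: "g \<in> carrier G" and "\<one> \<otimes> g \<otimes> inv \<one> \<in> H"
      unfolding N_def using one_closed by blast+
    then show "g \<in> H" by simp
  qed
  obtain r where r: "\<And>x. x \<in> carrier G \<Longrightarrow> r x \<in> carrier G"
      "\<And>x. x \<in> carrier G \<Longrightarrow> x \<otimes> inv (r x) \<in> H" "finite (r ` carrier G)"
    using finite_index_transversal[OF assms] by metis
  let ?R = "r ` carrier G"
  \<comment> \<open>The function attached to \<open>g\<close> is its action on the cosets, written on representatives; it
    takes equal values on \<open>g\<close> and \<open>g'\<close> only if these act in the same way.\<close>
  have "finite_index G N"
  proof (rule finite_indexI[OF sN, where B = "?R \<rightarrow>\<^sub>E ?R" and f = "\<lambda>g. restrict (\<lambda>a. r (a \<otimes> g)) ?R"])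
    show "finite (?R \<rightarrow>\<^sub>E ?R)" using r(3) by (intro finite_PiE) auto
    show "restrict (\<lambda>a. r (a \<otimes> g)) ?R \<in> ?R \<rightarrow>\<^sub>E ?R" if "g \<in> carrier G" for g
      using that r(1) by auto
    fix g g' assume g: "g \<in> carrier G" and g': "g' \<in> carrier G"
      and eq: "restrict (\<lambda>a. r (a \<otimes> g)) ?R = restrict (\<lambda>a. r (a \<otimes> g')) ?R"
    have "x \<otimes> (g \<otimes> inv g') \<otimes> inv x \<in> H" if x: "x \<in> carrier G" for x
    proof -
      define a h b where "a = r x" and "h = x \<otimes> inv (r x)" and "b = r (a \<otimes> g)"
      have a: "a \<in> carrier G" "a \<in> ?R" and h: "h \<in> H" and xa: "x = h \<otimes> a" and b: "b \<in> carrier G"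
        using r x g by (auto simp: a_def h_def b_def m_assoc)
      have hc: "h \<in> carrier G" using h by simp
      have "r (a \<otimes> g') = b" using fun_cong[OF eq, of a] a by (simp add: b_def)
      then have "a \<otimes> g \<otimes> inv b \<in> H" "a \<otimes> g' \<otimes> inv b \<in> H"
        using r(2)[of "a \<otimes> g"] r(2)[of "a \<otimes> g'"] a g g' by (auto simp: b_def)
      then have "h \<otimes> ((a \<otimes> g \<otimes> inv b) \<otimes> inv (a \<otimes> g' \<otimes> inv b)) \<otimes> inv h \<in> H" using h by simp
      then show ?thesis unfolding xa using a(1) b g g' hc by (simp add: word_simps)
    qed
    then show "g \<otimes> inv g' \<in> N" using g g' by (simp add: N_def)
  qed
  with nN NH that show thesis by blast
qed

end

section \<open>Words\<close>

abbreviation word_prod :: "('a, 'b) monoid_scheme \<Rightarrow> 'a list \<Rightarrow> 'a" where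
  "word_prod G w \<equiv> foldr (mult G) w \<one>\<^bsub>G\<^esub>"

context group
begin

lemma word_prod_closed: "set w \<subseteq> carrier G \<Longrightarrow> word_prod G w \<in> carrier G"
  by (induction w) auto

lemma word_prod_append:
  "set v \<subseteq> carrier G \<Longrightarrow> set w \<subseteq> carrier G \<Longrightarrow> word_prod G (v @ w) = word_prod G v \<otimes> word_prod G w"
  by (induction v) (auto simp: word_prod_closed m_assoc simp del: foldr_append)

lemma generate_imp_word:
  assumes "S \<subseteq> carrier G" "x \<in> generate G S"
  shows "\<exists>w. set w \<subseteq> S \<union> m_inv G ` S \<and> word_prod G w = x"
  using assms(2)
proof induction
  case one
  show ?case by (rule exI[of _ "[]"]) simp
next
  case (incl h)
  then show ?case using assms(1) by (intro exI[of _ "[h]"]) auto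
next
  case (inv h)
  then show ?case using assms(1) by (intro exI[of _ "[inv h]"]) auto
next
  case (eng x y)
  then obtain v w where vw: "set v \<subseteq> S \<union> m_inv G ` S" "word_prod G v = x"
    "set w \<subseteq> S \<union> m_inv G ` S" "word_prod G w = y" by auto
  moreover have "S \<union> m_inv G ` S \<subseteq> carrier G" using assms(1) by auto
  ultimately have "word_prod G (v @ w) = x \<otimes> y"
    by (subst word_prod_append) auto
  with vw show ?case by (intro exI[of _ "v @ w"]) auto
qed

text \<open>Reading a word from left to right and remembering only the representative \<open>a\<close> of the coset reached
  so far, each letter \<open>s\<close> contributes one Schreier generator \<open>a \<otimes> s \<otimes> inv b\<close>, where \<open>b\<close> represents the
  coset of \<open>a \<otimes> s\<close>.  Thus lengths do not grow: besides showing that a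
  subgroup of finite index is finitely generated, this compares its word lengths with those of \<open>G\<close>.
  The condition on \<open>R \<inter> H\<close> makes the remainder \<open>a\<close> disappear for words that represent elements
  of \<open>H\<close>.\<close>

lemma schreier_rewriting:
  assumes H: "finite_index G H" and A: "finite A" "A \<subseteq> carrier G"
  obtains T R where "finite T" "T \<subseteq> H" "finite R" "R \<subseteq> carrier G" "R \<inter> H \<subseteq> {\<one>}"
    and "\<And>w. set w \<subseteq> A \<Longrightarrow> \<exists>ts. \<exists>a \<in> R. set ts \<subseteq> T \<and> length ts = length w \<and>
      word_prod G w = word_prod G ts \<otimes> a"
proof -
  interpret H: subgroup H G using H by (simp add: finite_index_def)
  obtain r where r: "\<And>x. x \<in> carrier G \<Longrightarrow> r x \<in> carrier G"
      "\<And>x. x \<in> carrier G \<Longrightarrow> x \<otimes> inv (r x) \<in> H" "finite (r ` carrier G)"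
      "\<And>x. x \<in> H \<Longrightarrow> r x = \<one>"
    using finite_index_transversal[OF H] by metis
  define R where "R = r ` carrier G"
  define T where "T = (\<lambda>(a, s). a \<otimes> s \<otimes> inv (r (a \<otimes> s))) ` (R \<times> A)"
  have R: "finite R" "R \<subseteq> carrier G" using r by (auto simp: R_def)
  have T: "finite T" "T \<subseteq> H"
    using R A r(2)[OF m_closed] by (auto simp: T_def)
  have RH: "R \<inter> H \<subseteq> {\<one>}"
  proof
    fix a assume "a \<in> R \<inter> H"
    then obtain x where x: "x \<in> carrier G" "a = r x" and a: "a \<in> H" by (auto simp: R_def)
    have "(x \<otimes> inv a) \<otimes> a \<in> H" using r(2)[OF x(1)] x(2) a by simp
    then have "x \<in> H" using x r(1)[OF x(1)] by (simp add: word_simps)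
    then show "a \<in> {\<one>}" using r(4) x by simp
  qed
  show thesis
  proof (rule that[OF T R RH])
    fix w assume "set w \<subseteq> A"
    then show "\<exists>ts. \<exists>a \<in> R. set ts \<subseteq> T \<and> length ts = length w \<and> word_prod G w = word_prod G ts \<otimes> a"
    proof (induction w rule: rev_induct)
      case Nil
      have "\<one> \<in> R" unfolding R_def using r(4)[OF H.one_closed] one_closed by (metis imageI)
      then show ?case by (intro exI[of _ "[]"] bexI[of _ "\<one>"]) auto
    next
      case (snoc s w)
      then obtain ts a where ts: "set ts \<subseteq> T" "length ts = length w" "a \<in> R"
        "word_prod G w = word_prod G ts \<otimes> a" by auto
      have s: "s \<in> A" "s \<in> carrier G" "set w \<subseteq> carrier G" using snoc.prems A by auto
      define b where "b = r (a \<otimes> s)"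
      define t where "t = a \<otimes> s \<otimes> inv b"
      have a: "a \<in> carrier G" and b: "b \<in> R" "b \<in> carrier G"
        using ts(3) s R r(1) by (auto simp: b_def R_def)
      have t: "t \<in> T" using ts(3) s by (auto simp: t_def b_def T_def)
      have tsc: "set ts \<subseteq> carrier G" "t \<in> carrier G" using ts(1) t T(2) H.subset by auto
      have "word_prod G (w @ [s]) = word_prod G ts \<otimes> a \<otimes> s"
        using ts(4) s a tsc by (subst word_prod_append) (auto simp: word_prod_closed)
      also have "\<dots> = word_prod G ts \<otimes> t \<otimes> b"
        using word_prod_closed[OF tsc(1)] a b s by (simp add: t_def m_assoc)
      also have "\<dots> = word_prod G (ts @ [t]) \<otimes> b"
        using tsc by (subst word_prod_append) auto
      finally show ?case using ts t b by (intro exI[of _ "ts @ [t]"] bexI[of _ b]) auto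
    qed
  qed
qed

end

section \<open>Passing to smaller class when commutators are torsion\<close>

lemma (in comm_group) finite_subgroup_of_torsion_elements:
  assumes "finite X" "X \<subseteq> carrier G" "\<And>x. x \<in> X \<Longrightarrow> ord x \<noteq> 0"
  obtains B where "subgroup B G" "finite B" "X \<subseteq> B"
proof -
  have "\<exists>B. subgroup B G \<and> finite B \<and> X \<subseteq> B"
    using assms
  proof (induction X rule: finite_induct)
    case empty
    then show ?case using triv_subgroup by (intro exI[of _ "{\<one>}"]) auto
  next
    case (insert x X)
    then obtain B where B: "subgroup B G" "finite B" "X \<subseteq> B" by auto
    let ?C = "carrier (subgroup_generated G {x})"
    have x: "x \<in> carrier G" using insert.prems by auto
    have C: "subgroup ?C G" by (rule subgroup_subgroup_generated)
    have fC: "finite ?C" using insert.prems x by (simp add: finite_cyclic_subgroup_order)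
    have xC: "x \<in> ?C" using x by (simp add: carrier_subgroup_generated generate.incl)
    have "X \<subseteq> B <#> ?C"
    proof
      fix y assume "y \<in> X"
      then have "y \<in> B" "y \<in> carrier G" using B insert.prems by auto
      then have "y = y \<otimes> \<one>" by simp
      with \<open>y \<in> B\<close> show "y \<in> B <#> ?C"
        unfolding set_mult_def using subgroup.one_closed[OF C] by blast
    qed
    moreover have "x \<in> B <#> ?C"
    proof -
      have "x = \<one> \<otimes> x" using x by simp
      then show ?thesis unfolding set_mult_def using xC subgroup.one_closed[OF B(1)] by blast
    qed
    moreover have "finite (B <#> ?C)" using B(2) fC by (simp add: set_mult_def)
    moreover have "subgroup (B <#> ?C) G" using B(1) C by (rule mult_subgroups)
    ultimately show ?case by blast
  qed
  then show thesis using that by blast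
qed

lemma (in group) lower_central_subgroup_mono:
  assumes "subgroup H G"
  shows "lower_central (G\<lparr>carrier := H\<rparr>) n \<subseteq> lower_central G n"
proof (induction n)
  case 0
  show ?case using subgroup.subset[OF assms] by simp
next
  case (Suc n)
  interpret H: group "G\<lparr>carrier := H\<rparr>" using assms by (rule subgroup_imp_group)
  let ?H = "G\<lparr>carrier := H\<rparr>"
  let ?C = "{commutator ?H x y |x y. x \<in> lower_central ?H n \<and> y \<in> carrier ?H}"
  have "?C \<subseteq> lower_central G (Suc n)"
  proof safe
    fix x y assume x: "x \<in> lower_central ?H n" and y: "y \<in> carrier ?H"
    have "x \<in> H" using H.lower_central_carrier[OF x] by simp
    then have "commutator ?H x y = commutator G x y"
      using y assms by (simp add: commutator_def)
    also have "\<dots> \<in> lower_central G (Suc n)"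
      using x y Suc.IH subgroup.subset[OF assms] by (intro commutator_in_lower_central) auto
    finally show "commutator ?H x y \<in> lower_central G (Suc n)" .
  qed
  moreover have "?C \<subseteq> H"
  proof safe
    fix x y assume "x \<in> lower_central ?H n" "y \<in> carrier ?H"
    then show "commutator ?H x y \<in> H"
      using H.commutator_closed[of x y] H.lower_central_carrier[of x n] by simp
  qed
  ultimately show ?case
    unfolding H.lower_central_Suc_eq using generate_consistent[OF _ assms]
      generate_subgroup_incl[OF _ lower_central_subgroup] by auto
qed

context group_of_class_Suc
begin

text \<open>The subgroup \<open>K\<close> is the left kernel of the multilinear map given by the commutators of maximal weight
  (it is a term of the upper central series), so its own commutators of that weight vanish.  By
  multilinearity, membership in \<open>K\<close> is tested by the finitely many homomorphisms
  \<open>\<lambda>h. iterated_commutator G h ts\<close> with entries of \<open>ts\<close> in \<open>T\<close>.  Their values lie in the abelian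
  group generated by finitely many torsion elements, which is finite.\<close>

lemma torsion_commutators_imp_finite_index_lower_class:
  assumes T: "finite T" "T \<subseteq> carrier G" "generate G T = carrier G"
    and torsion: "\<And>t ts. t \<in> T \<Longrightarrow> set ts \<subseteq> T \<Longrightarrow> length ts = k \<Longrightarrow> ord (iterated_commutator G t ts) \<noteq> 0"
  shows "\<exists>K. finite_index G K \<and> lower_central (G\<lparr>carrier := K\<rparr>) k = {\<one>}"
proof -
  let ?IC = "iterated_commutator G"
  define K where "K = {h \<in> carrier G. \<forall>xs. set xs \<subseteq> carrier G \<and> length xs = k \<longrightarrow> ?IC h xs = \<one>}"
  have hom: "group_hom G G (\<lambda>h. ?IC h xs)" if "set xs \<subseteq> carrier G" "length xs = k" for xs
    using iterated_commutator_hom[OF that] by (simp add: group_hom.intro group_hom_axioms.intro is_group)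
  have sK: "subgroup K G"
  proof (rule subgroupI)
    have "\<one> \<in> K" by (simp add: K_def iterated_commutator_one)
    then show "K \<noteq> {}" by blast
  next
    fix a assume "a \<in> K"
    then show "inv a \<in> K" using group_hom.hom_inv[OF hom] by (auto simp: K_def)
  next
    fix a b assume "a \<in> K" "b \<in> K"
    then show "a \<otimes> b \<in> K" using hom_mult[OF group_hom.homh[OF hom]] by (auto simp: K_def)
  qed (auto simp: K_def)
  interpret K: group "G\<lparr>carrier := K\<rparr>" using sK by (rule subgroup_imp_group)
  let ?K = "G\<lparr>carrier := K\<rparr>"
  \<comment> \<open>Nested generation in the lower central series is handled by allowing the first entry to lie
    in its \<open>n\<close>-th term; the case \<open>n = k\<close> with no further entries is the claim.\<close>
  have vanish: "x \<in> lower_central ?K n \<Longrightarrow> set xs \<subseteq> carrier G \<Longrightarrow> n + length xs = k \<Longrightarrow> ?IC x xs = \<one>"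
    for n x xs
  proof (induction n arbitrary: x xs)
    case 0
    then show ?case by (simp add: K_def)
  next
    case (Suc n)
    let ?C = "{commutator ?K x y |x y. x \<in> lower_central ?K n \<and> y \<in> carrier ?K}"
    let ?V = "{x \<in> lower_central G (Suc n). ?IC x xs = \<one>}"
    note L = lower_central_subgroup[of "Suc n"]
    have len: "Suc n + length xs = k" and xs: "set xs \<subseteq> carrier G" using Suc.prems by auto
    note mult = iterated_commutator_mult[OF _ _ xs len]
    have V: "subgroup ?V G"
    proof (rule subgroupI)
      show "?V \<subseteq> carrier G" using subgroup.subset[OF L] by blast
      have "\<one> \<in> ?V" using iterated_commutator_one[OF xs] subgroup.one_closed[OF L] by simp
      then show "?V \<noteq> {}" by blast
    next
      fix a assume a: "a \<in> ?V"
      then have a': "inv a \<in> lower_central G (Suc n)" "a \<in> carrier G"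
        using subgroup.m_inv_closed[OF L] lower_central_carrier[of a "Suc n"] by simp_all
      have "\<one> = ?IC (a \<otimes> inv a) xs" using a'(2) xs by (simp add: iterated_commutator_one)
      also have "\<dots> = ?IC a xs \<otimes> ?IC (inv a) xs" using a a'(1) by (intro mult) simp_all
      also have "\<dots> = ?IC (inv a) xs" using a a'(2) xs by simp
      finally show "inv a \<in> ?V" using a'(1) by simp
    next
      fix a b assume "a \<in> ?V" "b \<in> ?V"
      then show "a \<otimes> b \<in> ?V" using mult[of a b] subgroup.m_closed[OF L] by simp
    qed
    have "?C \<subseteq> ?V"
    proof safe
      fix x y assume x: "x \<in> lower_central ?K n" and y: "y \<in> carrier ?K"
      have xy: "x \<in> K" "y \<in> K" "y \<in> carrier G"
        using K.lower_central_carrier[OF x] y by (auto simp: K_def)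
      then have eq: "commutator ?K x y = commutator G x y"
        using sK by (simp add: commutator_def)
      show "commutator ?K x y \<in> lower_central G (Suc n)"
        unfolding eq using x xy lower_central_subgroup_mono[OF sK]
        by (intro commutator_in_lower_central) auto
      show "?IC (commutator ?K x y) xs = \<one>"
        using Suc.IH[OF x, of "y # xs"] xy xs len by (simp add: eq)
    qed
    moreover have "?C \<subseteq> K"
    proof safe
      fix x y assume "x \<in> lower_central ?K n" "y \<in> carrier ?K"
      then show "commutator ?K x y \<in> K"
        using K.commutator_closed[of x y] K.lower_central_carrier[of x n] by simp
    qed
    ultimately have "lower_central ?K (Suc n) \<subseteq> ?V"
      unfolding K.lower_central_Suc_eq
      using generate_consistent[OF _ sK] generate_subgroup_incl[OF _ V] by auto
    then show ?case using Suc.prems(1) by auto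
  qed
  have "lower_central ?K k \<subseteq> {\<one>}" using vanish[of _ k "[]"] by auto
  moreover have "\<one> \<in> lower_central ?K k"
    using subgroup.one_closed[OF K.lower_central_subgroup[of k]] by simp
  ultimately have trivial: "lower_central ?K k = {\<one>}" by blast

  interpret Z: comm_group "G\<lparr>carrier := center G\<rparr>" by (rule center_comm_group)
  let ?L = "{ts. set ts \<subseteq> T \<and> length ts = k}"
  have fL: "finite ?L" using T(1) by (rule finite_lists_length_eq)
  let ?X = "(\<lambda>(t, ts). ?IC t ts) ` (T \<times> ?L)"
  have X: "finite ?X" using T(1) fL by simp
  have XZ: "?X \<subseteq> carrier (G\<lparr>carrier := center G\<rparr>)"
    using iterated_commutator_central[of _ 0] T(2) by auto
  have ordX: "group.ord (G\<lparr>carrier := center G\<rparr>) x \<noteq> 0" if x: "x \<in> ?X" for x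
  proof -
    have xz: "x \<in> center G" "x \<in> carrier G" using XZ x by (auto simp: center_def)
    have "ord x \<noteq> 0" using x torsion by auto
    then show ?thesis
      using Z.ord_eq_0[of x] ord_eq_0[of x] xz by (simp flip: nat_pow_consistent)
  qed
  obtain B where B: "subgroup B (G\<lparr>carrier := center G\<rparr>)" "finite B" "?X \<subseteq> B"
    using Z.finite_subgroup_of_torsion_elements[OF X XZ ordX] by blast
  have sB: "subgroup B G" using center_subgroup B(1) by (rule incl_subgroup)
  have IC_B: "?IC x ts \<in> B" if ts: "ts \<in> ?L" and x: "x \<in> carrier G" for x ts
  proof -
    interpret f: group_hom G G "\<lambda>h. ?IC h ts" using ts T(2) by (intro hom) auto
    have "(\<lambda>h. ?IC h ts) ` generate G T = generate G ((\<lambda>h. ?IC h ts) ` T)"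
      using f.generate_img[OF T(2)] by simp
    also have "\<dots> \<subseteq> B" using B(3) ts by (intro generate_subgroup_incl[OF _ sB]) auto
    finally show ?thesis using x T(3) by auto
  qed
  have "finite_index G K"
  proof (rule finite_indexI[OF sK, where B = "?L \<rightarrow>\<^sub>E B" and f = "\<lambda>x. restrict (?IC x) ?L"])
    show "finite (?L \<rightarrow>\<^sub>E B)" using fL B(2) by (intro finite_PiE) auto
    show "restrict (?IC x) ?L \<in> ?L \<rightarrow>\<^sub>E B" if "x \<in> carrier G" for x using IC_B that by auto
    fix x y assume x: "x \<in> carrier G" and y: "y \<in> carrier G"
      and eq: "restrict (?IC x) ?L = restrict (?IC y) ?L"
    have on_T: "?IC (x \<otimes> inv y) ts = \<one>" if ts: "set ts \<subseteq> T" "length ts = k" for ts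
    proof -
      have tsc: "set ts \<subseteq> carrier G" using ts T(2) by blast
      interpret f: group_hom G G "\<lambda>h. ?IC h ts" using tsc ts(2) by (rule hom)
      have "?IC x ts = ?IC y ts" using fun_cong[OF eq, of ts] ts by simp
      then show ?thesis using x y tsc by simp
    qed
    have "?IC (x \<otimes> inv y) xs = \<one>" if "set xs \<subseteq> carrier G" "length xs = k" for xs
      using iterated_commutator_vanishes[OF T(2,3), of "x \<otimes> inv y" 0 xs] on_T x y that by simp
    then show "x \<otimes> inv y \<in> K" using x y by (simp add: K_def)
  qed
  with trivial show ?thesis by blast
qed

end

section \<open>Additive functionals on abelian groups\<close>

context comm_group
begin

text \<open>The graph of a homomorphism to the additive group of the reals that is defined on some subgroup.
  With graphs, extending such a partial homomorphism is taking a larger set.\<close>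
definition additive_graph :: "('a \<times> real) set \<Rightarrow> bool" where
  "additive_graph R \<longleftrightarrow> R \<subseteq> carrier G \<times> UNIV \<and>
     (\<forall>x a y b. (x, a) \<in> R \<longrightarrow> (y, b) \<in> R \<longrightarrow> (x \<otimes> y, a + b) \<in> R) \<and>
     (\<forall>x a. (x, a) \<in> R \<longrightarrow> (inv x, - a) \<in> R) \<and>
     (\<one>, 0) \<in> R \<and> (\<forall>a. (\<one>, a) \<in> R \<longrightarrow> a = 0)"

lemma additive_graph_functional:
  assumes R: "additive_graph R" and "(x, a) \<in> R" "(x, b) \<in> R"
  shows "a = b"
proof -
  have "x \<in> carrier G" using assms by (auto simp: additive_graph_def)
  have "(x \<otimes> inv x, a + - b) \<in> R" using assms unfolding additive_graph_def by blast
  then have "(\<one>, a + - b) \<in> R" using \<open>x \<in> carrier G\<close> by simp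
  then have "a + - b = 0" using R unfolding additive_graph_def by blast
  then show ?thesis by simp
qed

lemma additive_graph_int_pow:
  assumes R: "additive_graph R" and xa: "(x, a) \<in> R"
  shows "(x [^] (i::int), of_int i * a) \<in> R"
proof -
  have x: "x \<in> carrier G" using assms by (auto simp: additive_graph_def)
  have nat: "(x [^] n, of_nat n * a) \<in> R" for n :: nat
  proof (induction n)
    case 0
    then show ?case using R by (simp add: additive_graph_def)
  next
    case (Suc n)
    then have "(x [^] n \<otimes> x, of_nat n * a + a) \<in> R"
      using R xa unfolding additive_graph_def by blast
    then show ?case by (simp add: algebra_simps)
  qed
  show ?thesis
  proof (cases i rule: int_cases2)
    case (nonneg n)
    then show ?thesis using nat[of n] by (simp add: int_pow_int)
  next
    case (nonpos n)
    have "(inv (x [^] n), - (of_nat n * a)) \<in> R"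
      using R nat[of n] unfolding additive_graph_def by blast
    then show ?thesis using nonpos x by (simp add: int_pow_neg int_pow_int)
  qed
qed

text \<open>The value at a new element \<open>x\<close> is forced if some nontrivial power of \<open>x\<close> is in the domain already,
  and arbitrary otherwise; divisibility of the reals makes the forced value exist.\<close>
lemma additive_graph_adjoin:
  assumes R: "additive_graph R" and x: "x \<in> carrier G"
  obtains R' where "additive_graph R'" "R \<subseteq> R'" "x \<in> fst ` R'"
proof -
  have one: "(\<one>, 0) \<in> R" and sub: "\<And>y b. (y, b) \<in> R \<Longrightarrow> y \<in> carrier G"
    using R by (auto simp: additive_graph_def)
  \<comment> \<open>The value \<open>a\<close> to be given to \<open>x\<close> has to agree with \<open>R\<close> on all powers of \<open>x\<close>; this is also enough
    for the enlarged relation to remain single-valued.\<close>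
  obtain a where a: "\<And>k b. (x [^] (k::int), b) \<in> R \<Longrightarrow> b = of_int k * a"
  proof (cases "\<exists>k b. (k::int) \<noteq> 0 \<and> (x [^] k, b) \<in> R")
    case False
    have "b = of_int k * 0" if "(x [^] (k::int), b) \<in> R" for k b
    proof -
      have "k = 0" using False that by blast
      then show ?thesis using additive_graph_functional[OF R _ one] that by simp
    qed
    then show thesis using that by blast
  next
    case True
    then obtain k b where k: "k \<noteq> 0" "(x [^] (k::int), b) \<in> R" by blast
    have "b' = of_int j * (b / of_int k)" if "(x [^] (j::int), b') \<in> R" for j b'
    proof -
      have "(x [^] (k * j), of_int j * b) \<in> R"
        using additive_graph_int_pow[OF R k(2), of j] x by (simp add: int_pow_pow)
      moreover have "(x [^] (k * j), of_int k * b') \<in> R"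
        using additive_graph_int_pow[OF R that, of k] x by (simp add: int_pow_pow mult.commute)
      ultimately have "of_int j * b = of_int k * b'" by (rule additive_graph_functional[OF R])
      then show ?thesis using k(1) by (simp add: field_simps)
    qed
    then show thesis using that by blast
  qed
  define R' where "R' = {(y \<otimes> x [^] (k::int), b + of_int k * a) |y b k. (y, b) \<in> R}"
  have R'I: "(y \<otimes> x [^] (k::int), b + of_int k * a) \<in> R'" if "(y, b) \<in> R" for y b k
    using that unfolding R'_def by blast
  have "additive_graph R'"
    unfolding additive_graph_def
  proof (intro conjI allI impI)
    show "R' \<subseteq> carrier G \<times> UNIV" using sub x by (auto simp: R'_def)
  next
    fix y b y' b' assume "(y, b) \<in> R'" "(y', b') \<in> R'"
    then obtain v c k v' c' k' where
      *: "(v, c) \<in> R" "y = v \<otimes> x [^] (k::int)" "b = c + of_int k * a"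
      "(v', c') \<in> R" "y' = v' \<otimes> x [^] (k'::int)" "b' = c' + of_int k' * a"
      unfolding R'_def by blast
    have v: "v \<in> carrier G" "v' \<in> carrier G" using * sub by auto
    have "(v \<otimes> v', c + c') \<in> R" using R * unfolding additive_graph_def by blast
    then have "((v \<otimes> v') \<otimes> x [^] (k + k'), (c + c') + of_int (k + k') * a) \<in> R'" by (rule R'I)
    moreover have "(v \<otimes> v') \<otimes> x [^] (k + k') = y \<otimes> y'"
      using v x * by (simp add: int_pow_mult m_ac)
    ultimately show "(y \<otimes> y', b + b') \<in> R'" using * by (simp add: algebra_simps)
  next
    fix y b assume "(y, b) \<in> R'"
    then obtain v c k where
      *: "(v, c) \<in> R" "y = v \<otimes> x [^] (k::int)" "b = c + of_int k * a"
      unfolding R'_def by blast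
    have "(inv v, - c) \<in> R" using R * unfolding additive_graph_def by blast
    then have "(inv v \<otimes> x [^] (- k), - c + of_int (- k) * a) \<in> R'" by (rule R'I)
    moreover have "inv v \<otimes> x [^] (- k) = inv y"
      using sub x * by (simp add: int_pow_neg inv_mult)
    ultimately show "(inv y, - b) \<in> R'" using * by simp
  next
    show "(\<one>, 0) \<in> R'" using R'I[OF one, of 0] by simp
  next
    fix b assume "(\<one>, b) \<in> R'"
    then obtain v c k where
      *: "(v, c) \<in> R" "\<one> = v \<otimes> x [^] (k::int)" "b = c + of_int k * a"
      unfolding R'_def by blast
    have "v = x [^] (- k)"
      using * sub x by (metis int_pow_closed int_pow_neg inv_equality inv_inv)
    then have "c = of_int (- k) * a" using a *(1) by blast
    then show "b = 0" using * by simp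
  qed
  moreover have "R \<subseteq> R'"
  proof (rule subrelI)
    fix y b assume "(y, b) \<in> R"
    then show "(y, b) \<in> R'" using R'I[of y b 0] sub by simp
  qed
  moreover have "x \<in> fst ` R'" using R'I[OF one, of 1] x by force
  ultimately show thesis using that by blast
qed

text \<open>An element of infinite order is not distorted in a finitely generated abelian group: this is what
  \<open>\<psi>\<close> witnesses, as it grows at most linearly in the word length and takes the value \<open>p\<close> at the
  \<open>p\<close>-th power of \<open>z\<close>.\<close>

lemma additive_functional_exists:
  assumes z: "z \<in> carrier G" "ord z = 0" and X: "finite X" "X \<subseteq> carrier G"
  obtains D and \<psi> :: "'a \<Rightarrow> real" where "subgroup D G" "z \<in> D" "X \<subseteq> D"
    and "\<And>x y. x \<in> D \<Longrightarrow> y \<in> D \<Longrightarrow> \<psi> (x \<otimes> y) = \<psi> x + \<psi> y" and "\<psi> z = 1"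
proof -
  have "\<exists>R. additive_graph R \<and> (z, 1) \<in> R \<and> X \<subseteq> fst ` R"
    using X
  proof (induction X rule: finite_induct)
    case empty
    let ?R = "{(z [^] (i::int), of_int i :: real) |i. True}"
    have "additive_graph ?R"
      unfolding additive_graph_def
    proof (intro conjI allI impI)
      show "?R \<subseteq> carrier G \<times> UNIV" using z by auto
    next
      fix x a y b assume "(x, a) \<in> ?R" "(y, b) \<in> ?R"
      then obtain i j where "x = z [^] (i::int)" "a = of_int i" "y = z [^] (j::int)" "b = of_int j" by auto
      then have "(x \<otimes> y, a + b) = (z [^] (i + j), of_int (i + j))"
        using z by (simp add: int_pow_mult)
      then show "(x \<otimes> y, a + b) \<in> ?R" by blast
    next
      fix x a assume "(x, a) \<in> ?R"
      then obtain i where "x = z [^] (i::int)" "a = of_int i" by auto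
      then have "(inv x, - a) = (z [^] (- i), of_int (- i))" using z by (simp add: int_pow_neg)
      then show "(inv x, - a) \<in> ?R" by blast
    next
      have "(\<one>, 0) = (z [^] (0::int), of_int 0 :: real)" by simp
      then show "(\<one>, 0) \<in> ?R" by blast
    next
      fix a assume "(\<one>, a) \<in> ?R"
      then obtain i where "\<one> = z [^] (i::int)" "a = of_int i" by auto
      then show "a = 0" using int_pow_eq_id[OF z(1), of i] z(2) by simp
    qed
    moreover have "(z, 1) \<in> ?R"
    proof -
      have "(z, 1) = (z [^] (1::int), of_int 1 :: real)" using z by simp
      then show ?thesis by blast
    qed
    ultimately show ?case by blast
  next
    case (insert x X)
    then obtain R where R: "additive_graph R" "(z, 1) \<in> R" "X \<subseteq> fst ` R" by auto
    obtain R' where "additive_graph R'" "R \<subseteq> R'" "x \<in> fst ` R'"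
      using additive_graph_adjoin[OF R(1)] insert.prems by blast
    then show ?case using R by blast
  qed
  then obtain R where R: "additive_graph R" "(z, 1) \<in> R" "X \<subseteq> fst ` R" by blast
  define \<psi> where "\<psi> x = (THE a. (x, a) \<in> R)" for x
  have \<psi>: "\<psi> x = a" if "(x, a) \<in> R" for x a
    unfolding \<psi>_def using that additive_graph_functional[OF R(1) _ that] by blast
  show thesis
  proof (rule that[of "fst ` R" \<psi>])
    show "subgroup (fst ` R) G"
    proof (rule subgroupI)
      show "fst ` R \<subseteq> carrier G" "fst ` R \<noteq> {}" using R by (auto simp: additive_graph_def)
    next
      fix x assume "x \<in> fst ` R"
      then obtain a where "(x, a) \<in> R" by auto
      then have "(inv x, - a) \<in> R" using R(1) unfolding additive_graph_def by blast
      then show "inv x \<in> fst ` R" by force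
    next
      fix x y assume "x \<in> fst ` R" "y \<in> fst ` R"
      then obtain a b where "(x, a) \<in> R" "(y, b) \<in> R" by auto
      then have "(x \<otimes> y, a + b) \<in> R" using R(1) unfolding additive_graph_def by blast
      then show "x \<otimes> y \<in> fst ` R" by force
    qed
    show "z \<in> fst ` R" using R(2) by force
    show "X \<subseteq> fst ` R" by (rule R(3))
    show "\<psi> z = 1" using R(2) by (rule \<psi>)
    fix x y assume "x \<in> fst ` R" "y \<in> fst ` R"
    then obtain a b where ab: "(x, a) \<in> R" "(y, b) \<in> R" by auto
    then have "(x \<otimes> y, a + b) \<in> R" using R(1) unfolding additive_graph_def by blast
    then show "\<psi> (x \<otimes> y) = \<psi> x + \<psi> y" using ab by (simp add: \<psi>)
  qed
qed

end

section \<open>The word norm and the conjugator length\<close>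

locale finitely_generated_group = group +
  fixes S :: "'a set"
  assumes generating: "finite_generating_set G S"
begin

abbreviation norm_S :: "'a \<Rightarrow> nat" where "norm_S \<equiv> word_norm G S"

definition letters :: "'a set" where "letters = S \<union> m_inv G ` S"

lemma letters_finite: "finite letters" and letters_closed: "letters \<subseteq> carrier G"
  and letters_inv: "s \<in> letters \<Longrightarrow> inv s \<in> letters"
  using generating by (auto simp: letters_def finite_generating_set_def)

lemma word_norm_le: "set w \<subseteq> letters \<Longrightarrow> norm_S (word_prod G w) \<le> length w"
  unfolding word_norm_def letters_def by (rule Least_le) blast

lemma geodesic_word:
  assumes "x \<in> carrier G"
  obtains w where "set w \<subseteq> letters" "length w = norm_S x" "word_prod G w = x"
proof -
  have "\<exists>w. set w \<subseteq> S \<union> m_inv G ` S \<and> word_prod G w = x"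
    using assms generating by (intro generate_imp_word) (auto simp: finite_generating_set_def)
  then have "\<exists>n w. length w = n \<and> set w \<subseteq> S \<union> m_inv G ` S \<and> word_prod G w = x" by blast
  from LeastI_ex[OF this] show thesis
    using that unfolding word_norm_def letters_def by blast
qed

lemma word_norm_mult:
  assumes "x \<in> carrier G" "y \<in> carrier G"
  shows "norm_S (x \<otimes> y) \<le> norm_S x + norm_S y"
proof -
  obtain v where v: "set v \<subseteq> letters" "length v = norm_S x" "word_prod G v = x"
    using geodesic_word[OF assms(1)] .
  obtain w where w: "set w \<subseteq> letters" "length w = norm_S y" "word_prod G w = y"
    using geodesic_word[OF assms(2)] .
  have "word_prod G (v @ w) = x \<otimes> y"
    using v w letters_closed by (subst word_prod_append) auto
  then show ?thesis using word_norm_le[of "v @ w"] v w by simp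
qed

lemma word_prod_rev_inv:
  "set w \<subseteq> carrier G \<Longrightarrow> word_prod G (rev (map (m_inv G) w)) = inv (word_prod G w)"
proof (induction w)
  case (Cons s w)
  then have "word_prod G (rev (map (m_inv G) (s # w))) = word_prod G (rev (map (m_inv G) w)) \<otimes> inv s"
    unfolding list.map rev.simps by (subst word_prod_append) auto
  then show ?case using Cons by (simp add: inv_mult_group word_prod_closed)
qed simp

lemma word_norm_inv:
  assumes "x \<in> carrier G"
  shows "norm_S (inv x) \<le> norm_S x"
proof -
  obtain w where w: "set w \<subseteq> letters" "length w = norm_S x" "word_prod G w = x"
    using geodesic_word[OF assms] .
  have "set w \<subseteq> carrier G" using w(1) letters_closed by blast
  then have "word_prod G (rev (map (m_inv G) w)) = inv x" using w by (simp add: word_prod_rev_inv)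
  moreover have "set (rev (map (m_inv G) w)) \<subseteq> letters" using w(1) letters_inv by auto
  ultimately show ?thesis using word_norm_le[of "rev (map (m_inv G) w)"] w(2) by simp
qed

lemma word_norm_one: "norm_S \<one> = 0"
  using word_norm_le[of "[]"] by simp

lemma word_norm_pow:
  assumes "x \<in> carrier G"
  shows "norm_S (x [^] (n::nat)) \<le> norm_S x * n"
proof (induction n)
  case 0
  then show ?case by (simp add: word_norm_one)
next
  case (Suc n)
  then show ?case using word_norm_mult[of "x [^] n" x] assms by simp
qed

lemma word_norm_commutator:
  assumes "x \<in> carrier G" "y \<in> carrier G"
  shows "norm_S (commutator G x y) \<le> 2 * (norm_S x + norm_S y)"
proof -
  have "norm_S (commutator G x y) \<le> norm_S x + norm_S y + norm_S (inv x) + norm_S (inv y)"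
    unfolding commutator_def using assms
    by (intro order.trans[OF word_norm_mult] add_right_mono) (auto intro: word_norm_mult)
  then show ?thesis using word_norm_inv[OF assms(1)] word_norm_inv[OF assms(2)] by simp
qed

text \<open>Commutators of sequences whose norm grows linearly have the same property, which is why \<open>f\<close> is an
  arbitrary sequence of this kind: the induction replaces it by its commutator with powers of \<open>y\<close>.\<close>
lemma word_norm_iterated_commutator_powers:
  assumes "\<And>m. f m \<in> carrier G" "\<And>m. norm_S (f m) \<le> C * m" "set ys \<subseteq> carrier G"
  shows "\<exists>C. \<forall>m. norm_S (iterated_commutator G (f m) (map (\<lambda>y. y [^] m) ys)) \<le> C * m"
  using assms
proof (induction ys arbitrary: f C)
  case Nil
  then show ?case by auto
next
  case (Cons y ys)
  let ?f = "\<lambda>m. commutator G (f m) (y [^] m)"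
  have y: "y \<in> carrier G" using Cons.prems by simp
  have "norm_S (?f m) \<le> (2 * (C + norm_S y)) * m" for m
    using word_norm_commutator[of "f m" "y [^] m"] Cons.prems(1,2)[of m] word_norm_pow[OF y, of m] y
    by (simp add: algebra_simps)
  moreover have "?f m \<in> carrier G" for m using Cons.prems(1) y by simp
  ultimately have "\<exists>C. \<forall>m. norm_S (iterated_commutator G (?f m) (map (\<lambda>y. y [^] m) ys)) \<le> C * m"
    using Cons.prems(3) by (intro Cons.IH) auto
  then show ?case by simp
qed

lemma finite_ball: "finite {x \<in> carrier G. norm_S x \<le> n}"
proof (rule finite_subset)
  show "{x \<in> carrier G. norm_S x \<le> n} \<subseteq> word_prod G ` {w. set w \<subseteq> letters \<and> length w \<le> n}"
  proof safe
    fix x assume "x \<in> carrier G" "norm_S x \<le> n"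
    then show "x \<in> word_prod G ` {w. set w \<subseteq> letters \<and> length w \<le> n}"
      by (auto elim!: geodesic_word)
  qed
  show "finite (word_prod G ` {w. set w \<subseteq> letters \<and> length w \<le> n})"
    using letters_finite by (simp add: finite_lists_length_le)
qed

lemma conj_length_le_function:
  assumes "conjugate G u v" "norm_S u \<le> n" "norm_S v \<le> n"
  shows "conj_length G S u v \<le> conj_length_function G S n"
  unfolding conj_length_function_def
proof (rule Max_ge)
  let ?B = "{x \<in> carrier G. norm_S x \<le> n}"
  have "{conj_length G S u v |u v. conjugate G u v \<and> norm_S u \<le> n \<and> norm_S v \<le> n}
      \<subseteq> (\<lambda>(u, v). conj_length G S u v) ` (?B \<times> ?B)"
    by (auto simp: conjugate_def)
  then show "finite {conj_length G S u v |u v. conjugate G u v \<and> norm_S u \<le> n \<and> norm_S v \<le> n}"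
    by (rule finite_subset) (intro finite_imageI finite_cartesian_product finite_ball)
qed (use assms in blast)

lemma conj_length_attained:
  assumes "conjugate G u v"
  obtains x where "x \<in> carrier G" "inv x \<otimes> u \<otimes> x = v" "norm_S x = conj_length G S u v"
proof -
  have "\<exists>l. \<exists>x \<in> carrier G. inv x \<otimes> u \<otimes> x = v \<and> norm_S x = l"
    using assms by (auto simp: conjugate_def)
  from LeastI_ex[OF this] show thesis using that unfolding conj_length_def by blast
qed

end

section \<open>Conjugators of central multiples are long\<close>

lemma (in group) iterated_commutator_subgroup:
  assumes H: "subgroup H G" and "x \<in> H" "set ys \<subseteq> H"
  shows "iterated_commutator (G\<lparr>carrier := H\<rparr>) x ys = iterated_commutator G x ys"
  using assms(2-)
proof (induction ys arbitrary: x)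
  case (Cons y ys)
  have "commutator (G\<lparr>carrier := H\<rparr>) x y = commutator G x y"
    using Cons.prems H by (simp add: commutator_def)
  moreover have "commutator G x y \<in> H"
    using Cons.prems H by (simp add: commutator_def subgroup.m_closed subgroup.m_inv_closed)
  ultimately show ?case using Cons by simp
qed simp

lemma (in group) subgroup_word_prod:
  assumes "subgroup H G" "set w \<subseteq> H"
  shows "word_prod G w \<in> H"
  using assms(2) by (induction w) (auto simp: subgroup.one_closed[OF assms(1)] subgroup.m_closed[OF assms(1)])

context group_of_class_Suc
begin

text \<open>Since \<open>u\<close> is central modulo the centre, conjugating \<open>u\<close> by \<open>g\<close> changes it by a central factor, and
  central factors accumulate multiplicatively.\<close>

lemma conjugation_defect_hom:
  assumes u: "u \<in> lower_central G j" and j: "Suc j = k"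
  shows "(\<lambda>g. inv g \<otimes> u \<otimes> g \<otimes> inv u) \<in> hom G (G\<lparr>carrier := center G\<rparr>)"
proof -
  have uc: "u \<in> carrier G" using u by (rule lower_central_carrier)
  let ?f = "\<lambda>g. inv g \<otimes> u \<otimes> g \<otimes> inv u"
  have central: "?f g \<in> center G" if g: "g \<in> carrier G" for g
  proof -
    have "?f g = commutator G (inv g) u" using g by (simp add: commutator_def)
    also have "\<dots> \<in> lower_central G (Suc j)" using u g by (intro commutator_in_lower_central') auto
    finally show ?thesis using last_lower_central_subset_center[OF lower_central_trivial] j by auto
  qed
  have comm: "x \<otimes> c = c \<otimes> x" if "c \<in> center G" "x \<in> carrier G" for c x
    using that by (simp add: center_def)
  have "?f (g \<otimes> h) = ?f g \<otimes> ?f h" if g: "g \<in> carrier G" and h: "h \<in> carrier G" for g h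
  proof -
    have "?f (g \<otimes> h) = inv h \<otimes> ?f g \<otimes> (u \<otimes> h \<otimes> inv u)" using g h uc by (simp add: word_simps)
    also have "inv h \<otimes> ?f g = ?f g \<otimes> inv h"
      using comm[OF central[OF g]] h by simp
    finally show ?thesis using g h uc by (simp add: m_assoc)
  qed
  with central show ?thesis by (auto simp: hom_def)
qed

lemma commutator_eq_conjugation_defect:
  assumes u: "u \<in> lower_central G j" and j: "Suc j = k" and h: "h \<in> carrier G"
  shows "commutator G u h = inv h \<otimes> u \<otimes> h \<otimes> inv u"
proof -
  have uc: "u \<in> carrier G" using u by (rule lower_central_carrier)
  have "commutator G u h \<in> center G"
    using commutator_in_lower_central[OF u h] j last_lower_central_subset_center[OF lower_central_trivial] by auto
  then have "commutator G u h \<otimes> h = h \<otimes> commutator G u h" using h by (simp add: center_def)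
  then have "inv h \<otimes> (commutator G u h \<otimes> h) = commutator G u h"
    using uc h by (simp add: inv_mult_cancel)
  then show ?thesis using uc h by (simp add: commutator_def word_simps)
qed

end

lemma (in group) center_normal_conj:
  assumes N: "N \<lhd> G" and z: "z \<in> center (G\<lparr>carrier := N\<rparr>)" and a: "a \<in> carrier G"
  shows "a \<otimes> z \<otimes> inv a \<in> center (G\<lparr>carrier := N\<rparr>)"
proof -
  interpret N: normal N G by (rule N)
  have zN: "z \<in> N" "z \<in> carrier G" and zc: "\<And>x. x \<in> N \<Longrightarrow> z \<otimes> x = x \<otimes> z"
    using z by (auto simp: center_def)
  have "(a \<otimes> z \<otimes> inv a) \<otimes> x = x \<otimes> (a \<otimes> z \<otimes> inv a)" if x: "x \<in> N" for x
  proof -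
    have y: "inv a \<otimes> x \<otimes> a \<in> N" using x a by (intro N.inv_op_closed1) auto
    have "(a \<otimes> z \<otimes> inv a) \<otimes> x = a \<otimes> (z \<otimes> (inv a \<otimes> x \<otimes> a)) \<otimes> inv a"
      using zN a x by (simp add: word_simps)
    also have "\<dots> = a \<otimes> ((inv a \<otimes> x \<otimes> a) \<otimes> z) \<otimes> inv a" using zc[OF y] by simp
    also have "\<dots> = x \<otimes> (a \<otimes> z \<otimes> inv a)" using zN a x by (simp add: word_simps)
    finally show ?thesis .
  qed
  moreover have "a \<otimes> z \<otimes> inv a \<in> N" using zN a by (intro N.inv_op_closed2) auto
  ultimately show ?thesis by (simp add: center_def)
qed

lemma (in group) conj_pow:
  assumes "a \<in> carrier G" "z \<in> carrier G"
  shows "(a \<otimes> z \<otimes> inv a) [^] (n::nat) = a \<otimes> z [^] n \<otimes> inv a"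
  using assms by (induction n) (simp_all add: word_simps)

text \<open>Write a conjugator from \<open>u\<close> to \<open>z [^] p \<otimes> u\<close> as \<open>g \<otimes> a\<close> with \<open>g\<close> in \<open>N\<close> and \<open>a\<close> in the finite set \<open>R\<close>.  Then
  \<open>\<theta> g = (a \<otimes> z \<otimes> inv a) [^] p \<otimes> d\<close>, where \<open>d\<close> depends on \<open>a\<close> only.  An additive functional on the centre of \<open>N\<close>
  that takes the value 1 at \<open>a \<otimes> z \<otimes> inv a\<close> is at most linear in the length of \<open>g\<close> on the left, while on
  the right it equals \<open>p\<close> up to a constant.  Conjugation by \<open>a\<close> need not fix \<open>z\<close>, so
  each \<open>a\<close> requires a functional of its own; finiteness of \<open>R\<close> makes the bound uniform.\<close>
lemma (in group) conjugator_length_linear_bound: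
  fixes N u
  defines "Z \<equiv> G\<lparr>carrier := center (G\<lparr>carrier := N\<rparr>)\<rparr>"
  defines "\<theta> \<equiv> \<lambda>g. inv g \<otimes> u \<otimes> g \<otimes> inv u"
  assumes N: "N \<lhd> G" and u: "u \<in> N" and hom: "\<theta> \<in> hom (G\<lparr>carrier := N\<rparr>) Z"
    and z: "z \<in> carrier Z" "ord z = 0"
    and T: "finite T" "T \<subseteq> N" and R: "finite R" "R \<subseteq> carrier G"
  obtains K :: real where "K \<ge> 0"
    and "\<And>ts a x p. set ts \<subseteq> T \<Longrightarrow> a \<in> R \<Longrightarrow> x = word_prod G ts \<otimes> a \<Longrightarrow>
      inv x \<otimes> u \<otimes> x = z [^] (p::nat) \<otimes> u \<Longrightarrow> real p \<le> K * real (length ts) + K"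
proof -
  interpret N: normal N G by (rule N)
  interpret GN: group "G\<lparr>carrier := N\<rparr>" by (rule N.subgroup_is_group[OF is_group])
  interpret Z: comm_group Z unfolding Z_def using GN.center_comm_group by simp
  have sZ: "subgroup (carrier Z) G"
    using incl_subgroup[OF N.subgroup_axioms GN.center_subgroup] by (simp add: Z_def)
  have Zmult: "x \<otimes>\<^bsub>Z\<^esub> y = x \<otimes> y" and Zone: "\<one>\<^bsub>Z\<^esub> = \<one>" and Zpow: "x [^]\<^bsub>Z\<^esub> n = x [^] n"
    for x y and n :: nat
    by (simp_all add: Z_def flip: nat_pow_consistent)
  have uc: "u \<in> carrier G" using u by simp
  have zc: "z \<in> carrier G" using z(1) subgroup.mem_carrier[OF sZ] by blast
  have \<theta>_Z: "\<theta> g \<in> carrier Z" if "g \<in> N" for g using hom that by (auto simp: hom_def)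
  have \<theta>_mult: "\<theta> (g \<otimes> h) = \<theta> g \<otimes> \<theta> h" if "g \<in> N" "h \<in> N" for g h
    using hom that by (auto simp: hom_def Zmult)
  have bound: "\<exists>K \<ge> 0. \<forall>ts x p. set ts \<subseteq> T \<longrightarrow> x = word_prod G ts \<otimes> a \<longrightarrow>
      inv x \<otimes> u \<otimes> x = z [^] (p::nat) \<otimes> u \<longrightarrow> real p \<le> K * real (length ts) + K"
    if aR: "a \<in> R" for a
  proof -
    have a: "a \<in> carrier G" using aR R by blast
    \<comment> \<open>The normality of \<open>N\<close> is used here: the conjugate of \<open>z\<close> is again central in \<open>N\<close>.\<close>
    define y where "y = a \<otimes> z \<otimes> inv a"
    define d where "d = a \<otimes> u \<otimes> inv a \<otimes> inv u"
    have yZ: "y \<in> carrier Z" using center_normal_conj[OF N _ a] z(1) by (simp add: y_def Z_def)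
    have yc: "y \<in> carrier G" and dc: "d \<in> carrier G" using a zc uc by (simp_all add: y_def d_def)
    have "y [^] n \<noteq> \<one>" if "n \<noteq> 0" for n :: nat
    proof
      assume "y [^] n = \<one>"
      then have "inv a \<otimes> (a \<otimes> z [^] n \<otimes> inv a) \<otimes> a = \<one>"
        using a zc by (simp add: y_def conj_pow)
      then have "z [^] n = \<one>" using a zc by (simp add: word_simps)
      then show False using z(2) zc that ord_eq_0 by blast
    qed
    then have y0: "Z.ord y = 0" using yZ by (simp add: Z.ord_eq_0 Zpow Zone)
    have "finite (\<theta> ` T)" "\<theta> ` T \<subseteq> carrier Z" using T \<theta>_Z by auto
    from Z.additive_functional_exists[OF yZ y0 this]
    obtain D and \<psi> :: "'a \<Rightarrow> real" where D: "subgroup D Z" "y \<in> D" "\<theta> ` T \<subseteq> D"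
      and \<psi>: "\<And>x y. x \<in> D \<Longrightarrow> y \<in> D \<Longrightarrow> \<psi> (x \<otimes> y) = \<psi> x + \<psi> y" "\<psi> y = 1"
      unfolding Zmult by metis
    have sD: "subgroup D G" using incl_subgroup[OF sZ] D(1) by (simp add: Z_def)
    interpret D: subgroup D G by (rule sD)
    have \<psi>_one: "\<psi> \<one> = 0" using \<psi>(1)[of \<one> \<one>] by simp
    have \<psi>_pow: "y [^] n \<in> D \<and> \<psi> (y [^] n) = real n" for n :: nat
      by (induction n) (simp_all add: \<psi> \<psi>_one D)
    define M where "M = (\<Sum>t\<in>T. \<bar>\<psi> (\<theta> t)\<bar>)"
    have M: "\<bar>\<psi> (\<theta> t)\<bar> \<le> M" if "t \<in> T" for t
      unfolding M_def using T(1) that by (intro member_le_sum) auto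
    have M0: "M \<ge> 0" by (simp add: M_def sum_nonneg)
    have word: "\<theta> (word_prod G ts) \<in> D \<and> \<bar>\<psi> (\<theta> (word_prod G ts))\<bar> \<le> M * real (length ts)"
      if "set ts \<subseteq> T" for ts
      using that
    proof (induction ts)
      case Nil
      have "\<theta> \<one> = \<one>" using uc by (simp add: \<theta>_def)
      then show ?case by (simp add: \<psi>_one)
    next
      case (Cons t ts)
      have tN: "t \<in> N" "word_prod G ts \<in> N"
        using Cons.prems T(2) subgroup_word_prod[OF N.subgroup_axioms, of ts] by auto
      have tD: "\<theta> t \<in> D" "\<bar>\<psi> (\<theta> t)\<bar> \<le> M" using Cons.prems D(3) M by auto
      have eq: "\<theta> (word_prod G (t # ts)) = \<theta> t \<otimes> \<theta> (word_prod G ts)"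
        using \<theta>_mult[OF tN] by simp
      show ?case unfolding eq using Cons tD \<psi>(1)[OF tD(1)] by (auto simp: algebra_simps)
    qed
    define K where "K = M + \<bar>\<psi> d\<bar>"
    have "real p \<le> K * real (length ts) + K"
      if ts: "set ts \<subseteq> T" and x: "x = word_prod G ts \<otimes> a"
        and xu: "inv x \<otimes> u \<otimes> x = z [^] (p::nat) \<otimes> u" for ts x p
    proof -
      let ?g = "word_prod G ts"
      have g: "?g \<in> N" using subgroup_word_prod[OF N.subgroup_axioms] ts T(2) by blast
      then have gc: "?g \<in> carrier G" by simp
      have "\<theta> ?g = a \<otimes> (inv x \<otimes> u \<otimes> x) \<otimes> inv a \<otimes> inv u"
        using a gc uc by (simp add: \<theta>_def x word_simps)
      also have "\<dots> = y [^] p \<otimes> d"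
        unfolding xu y_def d_def conj_pow[OF a zc] using a zc uc by (simp add: word_simps)
      finally have eq: "\<theta> ?g = y [^] p \<otimes> d" .
      then have "d = inv (y [^] p) \<otimes> \<theta> ?g" using yc dc by (simp add: inv_mult_cancel)
      \<comment> \<open>Although \<open>d\<close> need not be central in \<open>N\<close>, it is in the domain of \<open>\<psi>\<close> as soon as one such
        conjugator exists.\<close>
      then have "d \<in> D" using word[OF ts] \<psi>_pow[of p] by simp
      then have "\<psi> (\<theta> ?g) = real p + \<psi> d" using \<psi>(1) \<psi>_pow eq by simp
      then have "real p \<le> M * real (length ts) + \<bar>\<psi> d\<bar>" using word[OF ts] by linarith
      also have "\<dots> \<le> K * real (length ts) + K"
        using M0 by (intro add_mono mult_right_mono) (auto simp: K_def)
      finally show ?thesis .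
    qed
    moreover have "K \<ge> 0" using M0 by (simp add: K_def)
    ultimately show ?thesis by blast
  qed
  then obtain K where K: "\<And>a. a \<in> R \<Longrightarrow> K a \<ge> (0::real)"
    "\<And>a ts x p. a \<in> R \<Longrightarrow> set ts \<subseteq> T \<Longrightarrow> x = word_prod G ts \<otimes> a \<Longrightarrow>
      inv x \<otimes> u \<otimes> x = z [^] (p::nat) \<otimes> u \<Longrightarrow> real p \<le> K a * real (length ts) + K a"
    by metis
  show thesis
  proof (rule that[of "\<Sum>a\<in>R. K a"])
    show "(\<Sum>a\<in>R. K a) \<ge> 0" using K(1) by (rule sum_nonneg)
    fix ts a x p
    assume *: "set ts \<subseteq> T" "a \<in> R" "x = word_prod G ts \<otimes> a" "inv x \<otimes> u \<otimes> x = z [^] (p::nat) \<otimes> u"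
    have le: "K a \<le> (\<Sum>a\<in>R. K a)" using R(1) K(1) *(2) by (intro member_le_sum) auto
    have "real p \<le> K a * real (length ts) + K a" using K(2)[OF *(2,1,3,4)] .
    also have "\<dots> \<le> (\<Sum>a\<in>R. K a) * real (length ts) + (\<Sum>a\<in>R. K a)"
      using le by (intro add_mono mult_right_mono) auto
    finally show "real p \<le> (\<Sum>a\<in>R. K a) * real (length ts) + (\<Sum>a\<in>R. K a)" .
  qed
qed

section \<open>The lower bound for the conjugator length function\<close>

context finitely_generated_group
begin

text \<open>The witnesses are \<open>u\<close> and \<open>z [^] (n ^ Suc k) \<otimes> u\<close>, where \<open>z = commutator G u h\<close> is a commutator of weight
  \<open>k + 1\<close> in \<open>N\<close> of infinite order; \<open>h [^] (n ^ Suc k)\<close> conjugates one to the other.\<close>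
lemma power_le_conj_length_function:
  assumes N: "N \<lhd> G" "finite_index G N"
    and trivial: "lower_central (G\<lparr>carrier := N\<rparr>) (Suc k) = {\<one>}"
    and minimal: "\<And>K. finite_index G K \<Longrightarrow> lower_central (G\<lparr>carrier := K\<rparr>) k \<noteq> {\<one>}"
    and "k \<ge> 1"
  shows "(\<lambda>n. real n ^ Suc k) \<preceq>\<^sub>g (\<lambda>n. real (conj_length_function G S n))"
proof -
  interpret nN: normal N G by (rule N(1))
  let ?N = "G\<lparr>carrier := N\<rparr>"
  interpret N: group ?N by (rule nN.subgroup_is_group[OF is_group])
  interpret N: group_of_class_Suc ?N k by unfold_locales (simp add: trivial)
  obtain T R where T: "finite T" "T \<subseteq> N" and R: "finite R" "R \<subseteq> carrier G" "R \<inter> N \<subseteq> {\<one>}"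
    and rewriting: "\<And>w. set w \<subseteq> letters \<Longrightarrow> \<exists>ts. \<exists>a \<in> R. set ts \<subseteq> T \<and> length ts = length w \<and>
      word_prod G w = word_prod G ts \<otimes> a"
    using schreier_rewriting[OF N(2) letters_finite letters_closed] by metis
  have gen: "generate ?N T = carrier ?N"
  proof
    show "generate ?N T \<subseteq> carrier ?N" using T(2) by (intro N.generate_incl) simp
    show "carrier ?N \<subseteq> generate ?N T"
    proof
      fix h assume "h \<in> carrier ?N"
      then have h: "h \<in> N" "h \<in> carrier G" by auto
      obtain w where w: "set w \<subseteq> letters" "word_prod G w = h" using geodesic_word[OF h(2)] .
      obtain ts a where ts: "set ts \<subseteq> T" "a \<in> R" "h = word_prod G ts \<otimes> a"
        using rewriting[OF w(1)] w(2) by auto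
      have g: "word_prod G ts \<in> N" using subgroup_word_prod[OF nN.subgroup_axioms] ts T by blast
      have ac: "a \<in> carrier G" using ts R by blast
      have "inv (word_prod G ts) \<otimes> h \<in> N" using g h by simp
      then have "a \<in> N" unfolding ts(3) using g ac by (simp add: inv_mult_cancel)
      then have "a = \<one>" using R ts by blast
      then have "h = word_prod ?N ts" using ts g by simp
      moreover have "word_prod ?N ts \<in> generate ?N T"
        using T(2) ts(1) by (intro N.subgroup_word_prod N.generate_is_subgroup) (auto intro: generate.incl)
      ultimately show "h \<in> generate ?N T" by simp
    qed
  qed
  \<comment> \<open>If all commutators of weight \<open>k + 1\<close> in the generators were torsion, a subgroup of finite
    index would have smaller class.\<close>
  have "\<exists>t ts. t \<in> T \<and> set ts \<subseteq> T \<and> length ts = k \<and> N.ord (iterated_commutator ?N t ts) = 0"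
  proof (rule ccontr)
    assume "\<not> ?thesis"
    then obtain K where K: "finite_index ?N K" "lower_central (?N\<lparr>carrier := K\<rparr>) k = {\<one>\<^bsub>?N\<^esub>}"
      using N.torsion_commutators_imp_finite_index_lower_class[OF T(1) _ gen] T(2) by auto
    have "finite_index G K" using N(2) K(1) by (rule finite_index_trans)
    then show False using minimal K(2) by simp
  qed
  then obtain t ts where ts: "t \<in> T" "set ts \<subseteq> T" "length ts = k"
    and ord: "N.ord (iterated_commutator ?N t ts) = 0" by blast
  \<comment> \<open>The last entry can be split off because there are at least two entries in total; this is
    where the case of virtually abelian groups drops out.\<close>
  define us h where "us = butlast ts" and "h = last ts"
  have "ts \<noteq> []" using ts(3) assms(5) by auto
  then have ts_eq: "ts = us @ [h]" by (simp add: us_def h_def)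
  define u z where "u = iterated_commutator ?N t us" and "z = iterated_commutator ?N t ts"
  have in_N: "t \<in> N" "set us \<subseteq> N" "h \<in> N" "set ts \<subseteq> N" using ts T(2) ts_eq by auto
  have len: "Suc (length us) = k" using ts(3) ts_eq by simp
  have u: "u \<in> lower_central ?N (length us)"
    unfolding u_def using N.iterated_commutator_in_lower_central[of t 0 us] in_N by simp
  have uN: "u \<in> N" using N.lower_central_carrier[OF u] by simp
  then have uc: "u \<in> carrier G" by simp
  have z_eq: "z = commutator ?N u h" by (simp add: z_def u_def ts_eq)
  define \<theta> where "\<theta> = (\<lambda>g. inv g \<otimes> u \<otimes> g \<otimes> inv u)"
  let ?Z = "G\<lparr>carrier := center ?N\<rparr>"
  have \<theta>_N: "inv\<^bsub>?N\<^esub> g \<otimes>\<^bsub>?N\<^esub> u \<otimes>\<^bsub>?N\<^esub> g \<otimes>\<^bsub>?N\<^esub> inv\<^bsub>?N\<^esub> u = \<theta> g" if "g \<in> N" for g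
    using that uN nN.subgroup_axioms by (simp add: \<theta>_def)
  have hom: "\<theta> \<in> hom ?N ?Z"
    using N.conjugation_defect_hom[OF u len] \<theta>_N by (auto simp: hom_def Pi_iff)
  have z_\<theta>: "z = \<theta> h"
    using N.commutator_eq_conjugation_defect[OF u len, of h] in_N \<theta>_N by (simp add: z_eq)
  have zZ: "z \<in> carrier ?Z" using hom in_N by (auto simp: z_\<theta> hom_def)
  then have zN: "z \<in> N" by (simp add: center_def)
  then have zc: "z \<in> carrier G" by simp
  have ord_z: "ord z = 0"
    using ord zN zc by (simp add: z_def N.ord_eq_0 ord_eq_0 flip: nat_pow_consistent)

  obtain K :: real where K: "K \<ge> 0"
    "\<And>ts a x p. set ts \<subseteq> T \<Longrightarrow> a \<in> R \<Longrightarrow> x = word_prod G ts \<otimes> a \<Longrightarrow>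
      inv x \<otimes> u \<otimes> x = z [^] (p::nat) \<otimes> u \<Longrightarrow> real p \<le> K * real (length ts) + K"
    using conjugator_length_linear_bound[OF N(1) uN hom[unfolded \<theta>_def] zZ ord_z T R(1,2)] by metis

  have conj: "conjugate G u (z [^] p \<otimes> u)" for p :: nat
  proof -
    have hp: "h [^] p \<in> N" using in_N N.nat_pow_closed[of h p] by (simp flip: nat_pow_consistent)
    have "\<theta> (h [^] p) = z [^] p"
    proof (induction p)
      case 0
      show ?case using uc by (simp add: \<theta>_def)
    next
      case (Suc p)
      have "h [^] p \<in> N" using in_N N.nat_pow_closed[of h p] by (simp flip: nat_pow_consistent)
      then have "\<theta> (h [^] p \<otimes> h) = \<theta> (h [^] p) \<otimes> \<theta> h"
        using hom in_N by (auto simp: hom_def)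
      then show ?case using Suc by (simp add: z_\<theta>)
    qed
    then have "z [^] p \<otimes> u = \<theta> (h [^] p) \<otimes> u" by simp
    also have "\<dots> = inv (h [^] p) \<otimes> u \<otimes> h [^] p"
      using hp uc by (simp add: \<theta>_def m_assoc)
    finally show ?thesis using uc zc hp by (auto simp: conjugate_def)
  qed
  have lower: "real p \<le> K * real (conj_length G S u (z [^] p \<otimes> u)) + K" for p :: nat
  proof -
    obtain x where x: "x \<in> carrier G" "inv x \<otimes> u \<otimes> x = z [^] p \<otimes> u"
      "norm_S x = conj_length G S u (z [^] p \<otimes> u)"
      using conj_length_attained[OF conj] .
    obtain w where w: "set w \<subseteq> letters" "length w = norm_S x" "word_prod G w = x"
      using geodesic_word[OF x(1)] .
    obtain ts a where "set ts \<subseteq> T" "a \<in> R" "length ts = length w" "x = word_prod G ts \<otimes> a"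
      using rewriting[OF w(1)] w(3) by auto
    then show ?thesis using K(2)[of ts a x p] x w by simp
  qed

  obtain L where L: "\<And>m. norm_S (z [^] (m ^ Suc k)) \<le> L * m"
  proof -
    have "\<exists>C. \<forall>m. norm_S (iterated_commutator G (t [^] m) (map (\<lambda>y. y [^] m) ts)) \<le> C * m"
      using in_N by (intro word_norm_iterated_commutator_powers[of _ "norm_S t"] word_norm_pow) auto
    moreover have "iterated_commutator G (t [^] m) (map (\<lambda>y. y [^] m) ts) = z [^] (m ^ Suc k)" for m :: nat
    proof -
      have pow: "y [^] m \<in> N" if "y \<in> N" for y
        using that N.nat_pow_closed[of y m] by (simp flip: nat_pow_consistent)
      have "iterated_commutator ?N (t [^] m) (map (\<lambda>y. y [^] m) ts) = z [^] (m ^ Suc k)"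
        using N.iterated_commutator_pow[of t ts m] in_N ts(3) unfolding z_def
        by (simp flip: nat_pow_consistent)
      moreover have "set (map (\<lambda>y. y [^] m) ts) \<subseteq> N" using pow in_N(4) by auto
      ultimately show ?thesis
        using iterated_commutator_subgroup[OF nN.subgroup_axioms pow[OF in_N(1)]] by metis
    qed
    ultimately show thesis using that by auto
  qed

  define C where "C = Suc (L + norm_S u + nat \<lceil>K\<rceil>)"
  have KC: "K \<le> real C" by (simp add: C_def) linarith
  have "real n ^ Suc k \<le> real C * real (conj_length_function G S (C * n + C)) + real C" for n
  proof -
    let ?v = "z [^] (n ^ Suc k) \<otimes> u"
    have "norm_S u \<le> C * n + C" by (simp add: C_def)
    moreover have "norm_S ?v \<le> C * n + C"
    proof -
      have "norm_S ?v \<le> L * n + norm_S u"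
        using word_norm_mult[of "z [^] (n ^ Suc k)" u] L[of n] zc uc by simp
      also have "\<dots> \<le> C * n + C" by (intro add_mono mult_right_mono) (auto simp: C_def)
      finally show ?thesis .
    qed
    ultimately have le: "conj_length G S u ?v \<le> conj_length_function G S (C * n + C)"
      using conj by (intro conj_length_le_function)
    have "real n ^ Suc k \<le> K * real (conj_length G S u ?v) + K" using lower[of "n ^ Suc k"] by simp
    also have "\<dots> \<le> real C * real (conj_length_function G S (C * n + C)) + real C"
      using KC K(1) le by (intro add_mono mult_mono) auto
    finally show ?thesis .
  qed
  then show ?thesis unfolding growth_le_def by (intro exI[of _ C]) (auto simp: C_def)
qed

end

text \<open>Some subgroup of finite index realises the virtual class; passing to its normal core does not
  increase the class.\<close>
lemma (in group) normal_subgroup_of_virtual_class: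
  assumes "nilpotent G"
  obtains N where "N \<lhd> G" "finite_index G N"
    and "lower_central (G\<lparr>carrier := N\<rparr>) (virtual_nilpotency_class G) = {\<one>}"
proof -
  let ?P = "\<lambda>k. \<exists>H. finite_index G H \<and> nilpotency_class (G\<lparr>carrier := H\<rparr>) = k"
  have "finite_index G (carrier G)"
    by (rule finite_indexI[of _ "{()}" "\<lambda>_. ()"]) (auto simp: subgroup_self)
  then have "\<exists>k. ?P k" by blast
  from LeastI_ex[OF this]
  obtain H where H: "finite_index G H" "nilpotency_class (G\<lparr>carrier := H\<rparr>) = virtual_nilpotency_class G"
    unfolding virtual_nilpotency_class_def by auto
  have sH: "subgroup H G" using H by (simp add: finite_index_def)
  interpret H: group "G\<lparr>carrier := H\<rparr>" using sH by (rule subgroup_imp_group)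
  have one: "\<one> \<in> lower_central (G\<lparr>carrier := H\<rparr>) n" for n
    using subgroup.one_closed[OF H.lower_central_subgroup[of n]] by simp
  obtain n where "lower_central G n = {\<one>}" using assms by (auto simp: nilpotent_def)
  then have "lower_central (G\<lparr>carrier := H\<rparr>) n = {\<one>}"
    using lower_central_subgroup_mono[OF sH, of n] one by auto
  then have "\<exists>n. lower_central (G\<lparr>carrier := H\<rparr>) n = {\<one>\<^bsub>G\<lparr>carrier := H\<rparr>\<^esub>}" by auto
  from LeastI_ex[OF this] have class_H: "lower_central (G\<lparr>carrier := H\<rparr>) (virtual_nilpotency_class G) = {\<one>}"
    using H(2) by (simp add: nilpotency_class_def)
  obtain N where N: "N \<lhd> G" "N \<subseteq> H" "finite_index G N" using finite_index_normal_core[OF H(1)] .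
  have sN: "subgroup N G" using N by (simp add: finite_index_def)
  interpret N: group "G\<lparr>carrier := N\<rparr>" using sN by (rule subgroup_imp_group)
  have "lower_central (G\<lparr>carrier := N\<rparr>) (virtual_nilpotency_class G) \<subseteq> {\<one>}"
    using H.lower_central_subgroup_mono[OF subgroup_incl[OF sN sH N(2)]] class_H by auto
  then have "lower_central (G\<lparr>carrier := N\<rparr>) (virtual_nilpotency_class G) = {\<one>}"
    using subgroup.one_closed[OF N.lower_central_subgroup] by auto
  with N that show thesis by blast
qed

lemma virtual_nilpotency_class_le:
  assumes "finite_index G K" "lower_central (G\<lparr>carrier := K\<rparr>) k = {\<one>\<^bsub>G\<^esub>}"
  shows "virtual_nilpotency_class G \<le> k"
proof -
  have "virtual_nilpotency_class G \<le> nilpotency_class (G\<lparr>carrier := K\<rparr>)"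
    unfolding virtual_nilpotency_class_def using assms(1) by (intro Least_le) blast
  also have "\<dots> \<le> k"
    unfolding nilpotency_class_def using assms(2) by (intro Least_le) simp
  finally show ?thesis .
qed

theorem proposition2p11:
  fixes G :: "('a, 'b) monoid_scheme" and S :: "'a set" and c :: nat
  assumes "group G"
    and "finite_generating_set G S"
    and "nilpotent G"
    and "virtual_nilpotency_class G = c"
    and "c \<ge> 2"
  shows "(\<lambda>n. real n ^ c) \<preceq>\<^sub>g (\<lambda>n. real (conj_length_function G S n))"
proof -
  interpret finitely_generated_group G S
    using assms(1,2) by (intro finitely_generated_group.intro finitely_generated_group_axioms.intro)
  obtain k where k: "c = Suc k" "k \<ge> 1" using assms(5) by (cases c) auto
  obtain N where N: "N \<lhd> G" "finite_index G N" "lower_central (G\<lparr>carrier := N\<rparr>) (Suc k) = {\<one>\<^bsub>G\<^esub>}"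
    using normal_subgroup_of_virtual_class[OF assms(3)] assms(4) k(1) by metis
  have "lower_central (G\<lparr>carrier := K\<rparr>) k \<noteq> {\<one>\<^bsub>G\<^esub>}" if "finite_index G K" for K
    using virtual_nilpotency_class_le[OF that, of k] assms(4) k(1) by auto
  then show ?thesis
    unfolding k(1) using N k(2) by (intro power_le_conj_length_function) auto
qed

end
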